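(* Let $f(X)\in\mathbb{Z}[X]$ be a polynomial of degree $n\ge 1$ with splitting field $K$ over $\mathbb{Q}$ and leading coefficient $c_f$, let $S$ be a finite set of primes, and let $S'\subseteq S$ be the subset of all $p\in S$ such that $f$ has a root in $\mathbb{Z}_p$. Suppose that $s':=\#S'\ge 1$ and that all $p\in S'$ split completely in $K$ and do not divide $c_f$. Let $R(f)$ denote the largest multiplicity of a root of $f$ in $K$, and for real $B>0$ let $$N(f,S,\varepsilon,B):=\#\{x\in\mathbb{Z} : |x|\le B,\ 0<|f(x)|^{\varepsilon}\le [f(x)]_S\}.$$ Then, for any $\varepsilon\in(0,R(f)/n)$, one has $$N(f,S,\varepsilon,B)\asymp_{f,S,\varepsilon} B^{1-(n\varepsilon)/R(f)}(\log B)^{s'-1}\quad\text{as } B\to\infty.$$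
   Context: $\mathbb{Z}_p$ is the ring of $p$-adic integers and $v_p$ the $p$-adic valuation. For a non-zero integer $y$, the $S$-part of $y$ is $[y]_S:=\prod_{p\in S}p^{v_p(y)}$. The variable $B$ ranges over the positive reals. $F(B)\asymp_{f,S,\varepsilon} G(B)$ as $B\to\infty$ means that there are constants $c_1,c_2>0$ depending only on $f,S,\varepsilon$ such that $c_1G(B)\le F(B)\le c_2G(B)$ for all sufficiently large $B$. *)

theory Defs
  imports
    "HOL-Algebra.Algebraic_Closure_Type"
    "HOL-Algebra.Generated_Fields"
    "HOL-Algebra.Ideal_Product"
    "HOL-Computational_Algebra.Computational_Algebra"
    Complex_Main
begin

text \<open>
  The \<open>p\<close>-adic integers as the inverse limit of the rings \<open>\<int>/p\<^sup>k\<int>\<close>; the residue class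
  at level \<open>k\<close> is represented by its element of \<open>{0..<p ^ k}\<close>.
\<close>

definition padic_ints :: "nat \<Rightarrow> (nat \<Rightarrow> int) ring" where
  "padic_ints p = \<lparr>
     carrier = {a. \<forall>k. a k \<in> {0..<int p ^ k} \<and> a (Suc k) mod int p ^ k = a k},
     monoid.mult = (\<lambda>a b k. (a k * b k) mod int p ^ k),
     one = (\<lambda>k. 1 mod int p ^ k),
     ring.zero = (\<lambda>k. 0),
     add = (\<lambda>a b k. (a k + b k) mod int p ^ k)\<rparr>"

definition eval_int_poly :: "('a, 'b) ring_scheme \<Rightarrow> int poly \<Rightarrow> 'a \<Rightarrow> 'a" where
  "eval_int_poly R f x =
     (\<Oplus>\<^bsub>R\<^esub>i\<in>{..Polynomial.degree f}. [Polynomial.coeff f i] \<cdot>\<^bsub>R\<^esub> (x [^]\<^bsub>R\<^esub> i))"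

definition has_padic_int_root :: "int poly \<Rightarrow> nat \<Rightarrow> bool" where
  "has_padic_int_root f p \<longleftrightarrow>
     (\<exists>x\<in>carrier (padic_ints p). eval_int_poly (padic_ints p) f x = \<zero>\<^bsub>padic_ints p\<^esub>)"

text \<open>Splitting fields and number fields are realised as subfields of \<open>\<complex>\<close>.\<close>

abbreviation complex_field :: "complex ring" where
  "complex_field \<equiv> ring_of_type_algebra"

definition splitting_field :: "int poly \<Rightarrow> complex set" where
  "splitting_field f = generate_field complex_field {z. poly (map_poly of_int f) z = 0}"

definition ring_of_integers :: "complex set \<Rightarrow> complex ring" where
  "ring_of_integers K = complex_field\<lparr>carrier := {x \<in> K. algebraic_int x}\<rparr>"

text \<open>\<open>p\<O>\<^sub>K\<close> is a product of \<open>[K : \<rat>]\<close> distinct prime ideals of \<open>\<O>\<^sub>K\<close>.\<close>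

definition splits_completely :: "nat \<Rightarrow> complex set \<Rightarrow> bool" where
  "splits_completely p K \<longleftrightarrow>
     (\<exists>Ps. distinct Ps \<and>
           (\<forall>P\<in>set Ps. primeideal P (ring_of_integers K)) \<and>
           ring.dimension complex_field (length Ps) \<rat> K \<and>
           foldr (ideal_prod (ring_of_integers K)) Ps (carrier (ring_of_integers K))
             = PIdl\<^bsub>ring_of_integers K\<^esub> (of_nat p))"

definition max_root_multiplicity :: "int poly \<Rightarrow> nat" where
  "max_root_multiplicity f =
     Max ((\<lambda>z. Polynomial.order z (map_poly of_int f)) `
            {z \<in> splitting_field f. poly (map_poly of_int f) z = 0})"

definition S_part :: "nat set \<Rightarrow> int \<Rightarrow> nat" where
  "S_part S y = (\<Prod>p\<in>S. p ^ multiplicity (int p) y)"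

definition count_large_S_part :: "int poly \<Rightarrow> nat set \<Rightarrow> real \<Rightarrow> real \<Rightarrow> nat" where
  "count_large_S_part f S \<epsilon> B =
     card {x::int. \<bar>real_of_int x\<bar> \<le> B \<and>
             0 < \<bar>real_of_int (poly f x)\<bar> powr \<epsilon> \<and>
             \<bar>real_of_int (poly f x)\<bar> powr \<epsilon> \<le> real (S_part S (poly f x))}"

text \<open>
  The ring axioms are needed for the finite sum in \<^const>\<open>eval_int_poly\<close> to be meaningful over
  \<^const>\<open>padic_ints\<close>.
\<close>

lemma cring_padic_ints:
  assumes "p > 0"
  shows "cring (padic_ints p)"
proof (rule cringI)
  have pos: "int p ^ k > 0" for k
    using assms by simp
  have coh: "(c mod int p ^ Suc k) mod int p ^ k = c mod int p ^ k" for c k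
    by (rule mod_mod_cancel) simp
  have add_closed: "(\<lambda>k. (a k + b k) mod int p ^ k) \<in> carrier (padic_ints p)"
    if "a \<in> carrier (padic_ints p)" "b \<in> carrier (padic_ints p)" for a b
  proof -
    have "(a (Suc k) + b (Suc k)) mod int p ^ k = (a k + b k) mod int p ^ k" for k
      using that by (subst mod_add_eq [symmetric]) (simp add: padic_ints_def)
    then show ?thesis
      using pos coh unfolding padic_ints_def by (simp del: power_Suc)
  qed
  have mult_closed: "(\<lambda>k. (a k * b k) mod int p ^ k) \<in> carrier (padic_ints p)"
    if "a \<in> carrier (padic_ints p)" "b \<in> carrier (padic_ints p)" for a b
  proof -
    have "(a (Suc k) * b (Suc k)) mod int p ^ k = (a k * b k) mod int p ^ k" for k
      using that by (subst mod_mult_eq [symmetric]) (simp add: padic_ints_def)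
    then show ?thesis
      using pos coh unfolding padic_ints_def by (simp del: power_Suc)
  qed
  have neg_closed: "(\<lambda>k. (- a k) mod int p ^ k) \<in> carrier (padic_ints p)"
    if "a \<in> carrier (padic_ints p)" for a
  proof -
    have "(- a (Suc k)) mod int p ^ k = (- a k) mod int p ^ k" for k
      using that by (subst mod_minus_eq [symmetric]) (simp add: padic_ints_def)
    then show ?thesis
      using pos coh unfolding padic_ints_def by (simp del: power_Suc)
  qed
  have red: "a k mod int p ^ k = a k" if "a \<in> carrier (padic_ints p)" for a k
    using that by (simp add: padic_ints_def)
  have one_closed: "(\<lambda>k. 1 mod int p ^ k) \<in> carrier (padic_ints p)"
    using pos coh unfolding padic_ints_def by (simp del: power_Suc)
  have zero_closed: "(\<lambda>k. 0) \<in> carrier (padic_ints p)"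
    using pos unfolding padic_ints_def by simp
  show "abelian_group (padic_ints p)"
  proof (rule abelian_groupI, goal_cases)
    case (1 x y) then show ?case using add_closed by (simp add: padic_ints_def)
  next
    case 2 then show ?case using zero_closed by (simp add: padic_ints_def)
  next
    case (3 x y z) then show ?case
      by (simp add: padic_ints_def mod_simps add.assoc)
  next
    case (4 x y) then show ?case by (simp add: padic_ints_def add.commute)
  next
    case (5 x) then show ?case using red[of x] by (simp add: padic_ints_def)
  next
    case (6 x)
    show ?case
      by (rule bexI [OF _ neg_closed [OF 6]]) (simp add: padic_ints_def mod_simps)
  qed
  show "Group.comm_monoid (padic_ints p)"
  proof (rule comm_monoidI, goal_cases)
    case (1 x y) then show ?case using mult_closed by (simp add: padic_ints_def)
  next
    case 2 then show ?case using one_closed by (simp add: padic_ints_def)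
  next
    case (3 x y z) then show ?case
      by (simp add: padic_ints_def mod_simps mult.assoc)
  next
    case (4 x) then show ?case using red[of x] by (simp add: padic_ints_def mod_simps)
  next
    case (5 x y) then show ?case by (simp add: padic_ints_def mult.commute)
  qed
  show "(x \<oplus>\<^bsub>padic_ints p\<^esub> y) \<otimes>\<^bsub>padic_ints p\<^esub> z =
      x \<otimes>\<^bsub>padic_ints p\<^esub> z \<oplus>\<^bsub>padic_ints p\<^esub> y \<otimes>\<^bsub>padic_ints p\<^esub> z" for x y z
    by (simp add: padic_ints_def mod_simps distrib_right)
qed

end

(*
  Let p be a prime in S'. A degree count shows that the residue field of a prime P over p in the
  ring of integers of K is F_p: elements dual to the primes over p, together with a non-integral
  residue, would give more than [K : Q] numbers that are independent modulo p. Unramifiedness then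
  lets integers approximate every algebraic integer of K modulo all powers of P, so that p divides
  f(x) to a high power only if x is close to one of finitely many p-adic roots, and the p-part of
  f(x) is at most a constant times the R(f)-th power of the closeness. For p outside S' the p-part
  is bounded by compactness. Hence [f(x)]_S is governed by h^R(f), where h is the product of the
  p^(k p) expressing the closeness of x to roots at all p in S'. The condition becomes h >= c B^theta
  with theta = n eps / R(f) < 1; there are about (log B)^(s'-1) vectors k with h of that size up to
  a constant factor, each accounting for about B / h integers.
*)

theory Submission
  imports
    Defs
    "HOL-Number_Theory.Cong"
    "HOL-Library.FuncSet"
    "HOL-Real_Asymp.Real_Asymp"
begin

section \<open>Prime ideals of rings of algebraic integers\<close>

text \<open>The number of primes over \<open>p\<close> equals the dimension of K over the rationals,
  so residue degree one becomes a statement of linear algebra: one more number than the dimension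
  cannot stay independent. The ideals \<open>I k\<close> then act as a P-adic valuation with
  \<open>p\<close> itself as uniformiser, and they meet the integers in the multiples of
  \<open>p ^ k\<close>. Scaling the roots by the leading coefficient makes them algebraic integers;
  as that coefficient is invertible modulo \<open>p\<close>, the scaling can be undone in residues.
  Distinct roots separate at a finite level, so at most one factor of f(x) can carry an unbounded
  power of \<open>p\<close>. Two obstacles shape the count. The threshold for h varies with |x|, so
  the upper bound is summed over dyadic ranges, which converges geometrically because theta < 1.
  Congruence conditions for different exponent vectors overlap, so the lower bound fixes one root of
  maximal multiplicity per prime and prescribes the exact order of closeness, which makes the sets
  disjoint.\<close>

locale alg_int_ring =
  fixes A :: "complex set"
  assumes one_mem: "1 \<in> A"
    and add_mem: "x \<in> A \<Longrightarrow> y \<in> A \<Longrightarrow> x + y \<in> A"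
    and minus_mem: "x \<in> A \<Longrightarrow> - x \<in> A"
    and mult_mem: "x \<in> A \<Longrightarrow> y \<in> A \<Longrightarrow> x * y \<in> A"
    and algint: "x \<in> A \<Longrightarrow> algebraic_int x"
begin

lemma diff_mem: "x \<in> A \<Longrightarrow> y \<in> A \<Longrightarrow> x - y \<in> A"
  using add_mem[of x "- y"] minus_mem[of y] by simp

lemma zero_mem: "0 \<in> A"
  using diff_mem[OF one_mem one_mem] by simp

lemma of_nat_mem: "of_nat n \<in> A"
  by (induction n) (auto simp: zero_mem one_mem add_mem)

lemma of_int_mem: "of_int a \<in> A"
  by (cases a rule: int_cases2) (auto simp: of_nat_mem minus_mem)

lemma power_mem: "x \<in> A \<Longrightarrow> x ^ k \<in> A"
  by (induction k) (auto simp: one_mem mult_mem)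

lemma prod_mem: "(\<And>i. i \<in> I \<Longrightarrow> g i \<in> A) \<Longrightarrow> prod g I \<in> A"
  by (induction I rule: infinite_finite_induct) (auto simp: one_mem mult_mem)

lemma poly_mem: "x \<in> A \<Longrightarrow> poly (map_poly of_int g) x \<in> A"
  by (induction g) (auto simp: map_poly_pCons zero_mem of_int_mem add_mem mult_mem)

text \<open>Strip factors X from a monic integer polynomial vanishing at \<open>x\<close> until the
  constant term is nonzero; what remains exhibits that constant, up to sign, as a multiple of
  \<open>x\<close>. This does the work of the norm in \<open>I_separated\<close>.\<close>

lemma dvd_nonzero_int:
  assumes "x \<in> A" "x \<noteq> 0"
  shows "\<exists>w\<in>A. \<exists>m::int. m \<noteq> 0 \<and> x * w = of_int m"
proof -
  have "g \<noteq> 0 \<Longrightarrow> poly (map_poly of_int g) x = 0 \<Longrightarrow> ?thesis" for g :: "int poly"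
  proof (induction g)
    case (pCons a h)
    have h: "poly (map_poly of_int h) x \<in> A"
      using assms poly_mem by blast
    have eq: "of_int a + x * poly (map_poly of_int h) x = 0"
      using pCons.prems by (simp add: map_poly_pCons)
    show ?case
    proof (cases "a = 0")
      case True
      then show ?thesis using pCons eq assms by auto
    next
      case False
      have "x * poly (map_poly of_int h) x = of_int (- a)"
        using eq by (simp add: eq_neg_iff_add_eq_0 add.commute)
      then show ?thesis
        using False h by (intro bexI[of _ "poly (map_poly of_int h) x"] exI[of _ "- a"]) auto
    qed
  qed auto
  moreover obtain g :: "int poly" where "poly (map_poly of_int g) x = 0" "Polynomial.lead_coeff g = 1"
    using algint[OF assms(1)] algebraic_int_altdef_ipoly by blast
  ultimately show ?thesis
    by (metis Polynomial.coeff_0 zero_neq_one)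
qed

end

text \<open>The ideal is described by closure conditions on a set of complex numbers, so that all
  calculations are ordinary arithmetic in \<open>complex\<close>;
  \<open>prime_over_ring_of_integers\<close> translates from \<open>primeideal\<close>.\<close>

locale prime_over = alg_int_ring +
  fixes P :: "complex set" and p :: nat
  assumes prime_p: "Factorial_Ring.prime p"
    and P_subset: "P \<subseteq> A"
    and P_add: "x \<in> P \<Longrightarrow> y \<in> P \<Longrightarrow> x + y \<in> P"
    and P_mult: "x \<in> A \<Longrightarrow> y \<in> P \<Longrightarrow> x * y \<in> P"
    and P_prime: "x \<in> A \<Longrightarrow> y \<in> A \<Longrightarrow> x * y \<in> P \<Longrightarrow> x \<in> P \<or> y \<in> P"
    and one_notin: "1 \<notin> P"
    and p_mem: "of_nat p \<in> P"
begin

lemma P_minus: "x \<in> P \<Longrightarrow> - x \<in> P"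
  using P_mult[of "- 1" x] minus_mem[OF one_mem] by simp

lemma P_diff: "x \<in> P \<Longrightarrow> y \<in> P \<Longrightarrow> x - y \<in> P"
  using P_add[of x "- y"] P_minus[of y] by simp

lemma P_sum: "(\<And>i. i \<in> J \<Longrightarrow> g i \<in> P) \<Longrightarrow> sum g J \<in> P"
  using P_diff[OF p_mem p_mem]
  by (induction J rule: infinite_finite_induct) (auto simp: P_add)

lemma P_mult2: "x \<in> P \<Longrightarrow> y \<in> A \<Longrightarrow> x * y \<in> P"
  using P_mult[of y x] by (simp add: mult.commute)

lemma prime_int_p: "Factorial_Ring.prime (int p)"
  using prime_p by simp

lemma inverse_mod_p:
  assumes "\<not> int p dvd a"
  shows "\<exists>b. int p dvd a * b - 1"
proof -
  have "Rings.coprime a (int p)"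
    using prime_imp_coprime[OF prime_int_p assms] by (simp add: Rings.coprime_commute)
  then show ?thesis
    using cong_solve_coprime_int[of a "int p"] by (auto simp: cong_iff_dvd_diff)
qed

lemma int_mem_P_if_dvd: "int p dvd a \<Longrightarrow> of_int a \<in> P"
  using P_mult2[OF p_mem of_int_mem] by (auto elim!: dvdE)

lemma int_mem_P_iff: "of_int a \<in> P \<longleftrightarrow> int p dvd a"
proof
  assume a: "of_int a \<in> P"
  show "int p dvd a"
  proof (rule ccontr)
    assume "\<not> int p dvd a"
    then obtain b where "int p dvd a * b - 1"
      using inverse_mod_p by blast
    then have "of_int (a * b - 1) \<in> P"
      by (rule int_mem_P_if_dvd)
    moreover have "of_int (a * b) \<in> P"
      using P_mult2[OF a of_int_mem[of b]] by simp
    ultimately have "of_int (a * b) - of_int (a * b - 1) \<in> P"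
      by (rule P_diff[rotated])
    then show False using one_notin by simp
  qed
qed (rule int_mem_P_if_dvd)

text \<open>
  Prime ideals over \<open>p\<close> are maximal: in a monic integer polynomial of least degree whose value
  at \<open>x\<close> lies in \<open>P\<close>, the constant term is prime to \<open>p\<close>, hence invertible modulo \<open>P\<close>.
\<close>

lemma inverse_mod_P:
  assumes "x \<in> A" "x \<notin> P"
  shows "\<exists>w\<in>A. x * w - 1 \<in> P"
proof -
  have "Polynomial.lead_coeff g = 1 \<Longrightarrow> poly (map_poly of_int g) x \<in> P \<Longrightarrow> ?thesis" for g :: "int poly"
  proof (induction g)
    case (pCons a h)
    define y where "y = poly (map_poly of_int h) x"
    have y: "y \<in> A" using poly_mem assms by (simp add: y_def)
    have g: "of_int a + x * y \<in> P"
      using pCons.prems by (simp add: map_poly_pCons y_def)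
    show ?case
    proof (cases "h = 0")
      case True
      then show ?thesis using pCons.prems one_notin by (simp add: map_poly_pCons)
    next
      case h: False
      show ?thesis
      proof (cases "int p dvd a")
        case True
        then have "of_int a + x * y - of_int a \<in> P"
          using g int_mem_P_if_dvd P_diff by blast
        then have "y \<in> P"
          using P_prime assms y by auto
        then show ?thesis using pCons h by (simp add: y_def)
      next
        case False
        then obtain b where "int p dvd a * b - 1"
          using inverse_mod_p by blast
        then have ab: "of_int (a * b - 1) \<in> P"
          by (rule int_mem_P_if_dvd)
        have "of_int b * (of_int a + x * y) - of_int (a * b - 1) \<in> P"
          using P_diff[OF P_mult[OF of_int_mem g] ab] .
        then have "- (of_int b * (of_int a + x * y) - of_int (a * b - 1)) \<in> P"
          by (rule P_minus)
        moreover have "- (of_int b * (of_int a + x * y) - of_int (a * b - 1))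
            = x * (- of_int b * y) - 1"
          by (simp add: algebra_simps)
        moreover have "- of_int b * y \<in> A"
          using minus_mem[OF of_int_mem] y mult_mem by blast
        ultimately show ?thesis by metis
      qed
    qed
  qed auto
  moreover obtain g :: "int poly" where "poly (map_poly of_int g) x = 0" "Polynomial.lead_coeff g = 1"
    using algint[OF assms(1)] algebraic_int_altdef_ipoly by blast
  moreover have "0 \<in> P"
    using P_diff[OF p_mem p_mem] by simp
  ultimately show ?thesis by metis
qed

lemma prod_notin_P:
  assumes "\<And>i. i \<in> I \<Longrightarrow> g i \<in> A" "\<And>i. i \<in> I \<Longrightarrow> g i \<notin> P"
  shows "prod g I \<notin> P"
  using assms
proof (induction I rule: infinite_finite_induct)
  case (insert i I)
  then have "prod g I \<in> A" "prod g I \<notin> P" by (auto intro: prod_mem)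
  then show ?case using insert P_prime by auto
qed (auto simp: one_notin)

text \<open>Maximality makes the primes over \<open>p\<close> incomparable: an \<open>x\<close> in
  \<open>P\<close> outside \<open>P'\<close> is invertible modulo \<open>P'\<close>, and an
  inclusion of \<open>P'\<close> in \<open>P\<close> would then put 1 into \<open>P\<close>.\<close>

lemma not_subset_prime_over:
  assumes "prime_over A P' p" "P' \<noteq> P"
  shows "\<exists>x\<in>P'. x \<notin> P"
proof (rule ccontr)
  interpret P': prime_over A P' p by fact
  assume contra: "\<not> (\<exists>x\<in>P'. x \<notin> P)"
  then obtain x where x: "x \<in> P" "x \<notin> P'"
    using assms by blast
  then obtain w where w: "w \<in> A" "x * w - 1 \<in> P'"
    using P'.inverse_mod_P P_subset by blast
  then have "x * w - 1 \<in> P"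
    using contra by blast
  moreover have "x * w \<in> P"
    using x w P_mult2 by blast
  ultimately have "x * w - (x * w - 1) \<in> P"
    using P_diff by blast
  then show False using one_notin by simp
qed

end

text \<open>
  A prime over \<open>p\<close> of degree one and unramified; \<open>q\<close> stands for the product of the other
  primes over \<open>p\<close>.
\<close>

locale split_prime = prime_over +
  fixes q :: complex
  assumes residue: "x \<in> A \<Longrightarrow> \<exists>a::int. x - of_int a \<in> P"
    and q_mem: "q \<in> A" "q \<notin> P"
    and q_mult: "y \<in> P \<Longrightarrow> \<exists>z\<in>A. q * y = of_nat p * z"
begin

text \<open>The contraction to \<open>A\<close> of the ideal generated by \<open>p\<^sup>k\<close> in the localisation of \<open>A\<close> at \<open>P\<close>.\<close>

definition I :: "nat \<Rightarrow> complex set" where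
  "I k = {y \<in> A. \<exists>u\<in>A - P. \<exists>z\<in>A. u * y = of_nat p ^ k * z}"

lemma A_minus_P_mult: "u \<in> A - P \<Longrightarrow> v \<in> A - P \<Longrightarrow> u * v \<in> A - P"
  using P_prime mult_mem by blast

lemma I_mem_A: "x \<in> I k \<Longrightarrow> x \<in> A"
  by (auto simp: I_def)

lemma I_0: "I 0 = A"
  using one_mem one_notin by (force simp: I_def intro: mult_mem)

lemma I_add:
  assumes "x \<in> I k" "y \<in> I k"
  shows "x + y \<in> I k"
proof -
  obtain u z v w where *: "u \<in> A - P" "z \<in> A" "u * x = of_nat p ^ k * z"
    "v \<in> A - P" "w \<in> A" "v * y = of_nat p ^ k * w"
    using assms by (auto simp: I_def)
  have "(u * v) * (x + y) = v * (u * x) + u * (v * y)" by (simp add: algebra_simps)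
  also have "\<dots> = of_nat p ^ k * (v * z + u * w)" using * by (simp add: algebra_simps)
  finally have "(u * v) * (x + y) = of_nat p ^ k * (v * z + u * w)" .
  moreover have "v * z + u * w \<in> A" using * by (auto intro!: add_mem mult_mem)
  moreover have "x + y \<in> A" using assms I_mem_A add_mem by blast
  ultimately show ?thesis
    using A_minus_P_mult *(1,4) unfolding I_def by blast
qed

lemma I_mult:
  assumes "x \<in> I j" "y \<in> I k"
  shows "x * y \<in> I (j + k)"
proof -
  obtain u z v w where *: "u \<in> A - P" "z \<in> A" "u * x = of_nat p ^ j * z"
    "v \<in> A - P" "w \<in> A" "v * y = of_nat p ^ k * w"
    using assms by (auto simp: I_def)
  have "(u * v) * (x * y) = (u * x) * (v * y)" by (simp add: algebra_simps)
  also have "\<dots> = of_nat p ^ (j + k) * (z * w)" using * by (simp add: algebra_simps power_add)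
  finally have "(u * v) * (x * y) = of_nat p ^ (j + k) * (z * w)" .
  moreover have "z * w \<in> A" using * by (auto intro!: mult_mem)
  moreover have "x * y \<in> A" using assms I_mem_A mult_mem by blast
  ultimately show ?thesis
    using A_minus_P_mult *(1,4) unfolding I_def by blast
qed

lemma I_absorb: "x \<in> A \<Longrightarrow> y \<in> I k \<Longrightarrow> x * y \<in> I k"
  using I_mult[of x 0 y k] by (simp add: I_0)

lemma I_minus: "x \<in> I k \<Longrightarrow> - x \<in> I k"
  using I_absorb[of "- 1" x k] minus_mem[OF one_mem] by simp

lemma I_diff: "x \<in> I k \<Longrightarrow> y \<in> I k \<Longrightarrow> x - y \<in> I k"
  using I_add[of x k "- y"] I_minus by simp

lemma I_power: "x \<in> I k \<Longrightarrow> x ^ m \<in> I (m * k)"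
  by (induction m) (auto simp: I_0 one_mem intro: I_mult)

lemma I_antimono:
  assumes "j \<le> k"
  shows "I k \<subseteq> I j"
proof
  fix x assume x: "x \<in> I k"
  then obtain u z where *: "u \<in> A - P" "z \<in> A" "u * x = of_nat p ^ k * z"
    by (auto simp: I_def)
  have "of_nat p ^ k = (of_nat p ^ j * of_nat p ^ (k - j) :: complex)"
    using assms by (simp flip: power_add)
  then have "u * x = of_nat p ^ j * (of_nat p ^ (k - j) * z)"
    using * by simp
  moreover have "of_nat p ^ (k - j) * z \<in> A"
    using * by (auto intro!: mult_mem power_mem of_nat_mem)
  ultimately show "x \<in> I j"
    using * x unfolding I_def by blast
qed

text \<open>Factors of \<open>p\<close> are peeled off singly: after cancelling
  \<open>p ^ k\<close>, a relation \<open>u * b = p * z\<close> with \<open>u\<close> outside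
  \<open>P\<close> forces \<open>b\<close> into \<open>P\<close>, whose integers are the multiples
  of \<open>p\<close>. Through this equivalence the results return to congruences between
  integers.\<close>

lemma int_mem_I_iff: "of_int a \<in> I k \<longleftrightarrow> int p ^ k dvd a"
proof
  assume "int p ^ k dvd a"
  then obtain b where "a = int p ^ k * b" by blast
  then show "of_int a \<in> I k"
    using I_mult[of "of_nat p ^ k" k "of_int b" 0] of_nat_mem[of p] power_mem of_int_mem[of b]
      one_mem one_notin unfolding I_0 by (force simp: I_def)
next
  show "of_int a \<in> I k \<Longrightarrow> int p ^ k dvd a"
  proof (induction k arbitrary: a)
    case (Suc k)
    then obtain u z where *: "u \<in> A - P" "z \<in> A" "u * of_int a = of_nat p ^ Suc k * z"
      by (auto simp: I_def)
    have "of_int a \<in> I k" using Suc.prems I_antimono[of k "Suc k"] by auto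
    then obtain b where b: "a = int p ^ k * b" using Suc.IH by blast
    have "p \<noteq> 0" using prime_p by auto
    then have "u * of_int b = of_nat p * z"
      using * b by simp
    then have "u * of_int b \<in> P"
      using P_mult2[OF p_mem] * by simp
    then have "of_int b \<in> P"
      using P_prime * of_int_mem by blast
    then show ?case
      using b by (auto simp: int_mem_P_iff)
  qed auto
qed

text \<open>Determines one p-adic digit at a time. If \<open>x - a\<close> is
  \<open>p ^ k * b / u\<close> with \<open>u\<close> a unit at \<open>P\<close>, the next digit is
  an integer \<open>c\<close> congruent to \<open>b / u\<close> modulo \<open>P\<close>, which
  exists because the residue field has \<open>p\<close> elements.\<close>

lemma I_residue:
  assumes "x \<in> A"
  shows "\<exists>a::int. x - of_int a \<in> I k"
proof (induction k)
  case 0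
  show ?case using assms I_0 by (intro exI[of _ 0]) simp
next
  case (Suc k)
  then obtain a where a: "x - of_int a \<in> I k" by blast
  then obtain u b where *: "u \<in> A - P" "b \<in> A" "u * (x - of_int a) = of_nat p ^ k * b"
    by (auto simp: I_def)
  obtain w where w: "w \<in> A" "u * w - 1 \<in> P"
    using inverse_mod_P * by blast
  obtain c :: int where c: "w * b - of_int c \<in> P"
    using residue mult_mem w * by blast
  have "u * (w * b - of_int c) - b * (u * w - 1) \<in> P"
    using P_diff P_mult c w * by blast
  then have "b - u * of_int c \<in> P"
    by (simp add: algebra_simps)
  \<comment> \<open>Unramifiedness enters here: \<open>q\<close>, a unit at \<open>P\<close>, turns
    an arbitrary element of \<open>P\<close> into a multiple of \<open>p\<close>, which supplies the
    additional factor \<open>p\<close>.\<close>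
  then obtain z where z: "z \<in> A" "q * (b - u * of_int c) = of_nat p * z"
    using q_mult by blast
  have "(u * q) * (x - of_int (a + int p ^ k * c))
      = q * (u * (x - of_int a)) - q * u * of_nat p ^ k * of_int c"
    by (simp add: algebra_simps)
  also have "\<dots> = of_nat p ^ k * (q * (b - u * of_int c))"
    using * by (simp add: algebra_simps)
  also have "\<dots> = of_nat p ^ Suc k * z"
    using z by simp
  finally have "(u * q) * (x - of_int (a + int p ^ k * c)) = of_nat p ^ Suc k * z" .
  moreover have "u * q \<in> A - P"
    using A_minus_P_mult * q_mem by blast
  ultimately have "x - of_int (a + int p ^ k * c) \<in> I (Suc k)"
    unfolding I_def using z(1) diff_mem[OF assms of_int_mem] by blast
  then show ?case by blast
qed

text \<open>A nonzero integer multiple \<open>m\<close> of \<open>x\<close> would lie in every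
  \<open>I k\<close>, so every power of \<open>p\<close> would divide \<open>m\<close>.\<close>

lemma I_separated:
  assumes "x \<in> A" "x \<noteq> 0"
  shows "\<exists>k. x \<notin> I k"
proof -
  obtain w m where *: "w \<in> A" "m \<noteq> 0" "x * w = of_int m"
    using dvd_nonzero_int[OF assms] by blast
  have False if "\<forall>k. x \<in> I k"
  proof -
    have "int p ^ k dvd m" for k
      using that I_absorb[of w x k] * by (simp add: mult.commute flip: int_mem_I_iff)
    then have "p ^ k dvd nat \<bar>m\<bar>" for k
      by (metis dvd_abs_iff int_dvd_int_iff of_nat_power int_nat_eq abs_ge_zero nat_0_le)
    then have "p ^ k \<le> nat \<bar>m\<bar>" for k
      using * by (intro dvd_imp_le) auto
    moreover have "p ^ k > k" for k
      using prime_gt_Suc_0_nat[OF prime_p] by (intro power_gt_expt) auto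
    ultimately show False
      by (metis not_less)
  qed
  then show ?thesis by blast
qed

end

section \<open>Primes that split completely\<close>

lemma complex_field_simps [simp]:
  "carrier complex_field = UNIV" "x \<otimes>\<^bsub>complex_field\<^esub> y = x * y" "x \<oplus>\<^bsub>complex_field\<^esub> y = x + y"
  "\<one>\<^bsub>complex_field\<^esub> = 1" "\<zero>\<^bsub>complex_field\<^esub> = 0"
  by (simp_all add: ring_of_type_algebra_def)

lemma ring_of_integers_simps [simp]:
  "carrier (ring_of_integers K) = {x \<in> K. algebraic_int x}"
  "x \<otimes>\<^bsub>ring_of_integers K\<^esub> y = x * y" "x \<oplus>\<^bsub>ring_of_integers K\<^esub> y = x + y"
  "\<one>\<^bsub>ring_of_integers K\<^esub> = 1" "\<zero>\<^bsub>ring_of_integers K\<^esub> = 0"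
  by (simp_all add: ring_of_integers_def ring_of_type_algebra_def)

interpretation complex_field: Ring.ring complex_field
  by (rule ring_from_type_algebra)

lemma a_inv_complex_field [simp]: "\<ominus>\<^bsub>complex_field\<^esub> x = - x"
  using complex_field.l_neg[of x] by (simp add: eq_neg_iff_add_eq_0)

lemma m_inv_complex_field [simp]: "x \<noteq> 0 \<Longrightarrow> inv\<^bsub>complex_field\<^esub> x = inverse x"
  using complex_field.inv_unique'[of x "inverse x"] by simp

lemma subfield_Rats: "subfield \<rat> complex_field"
proof (rule field.subfieldI'[OF field_from_type_algebra], rule complex_field.subringI)
qed auto

lemma combine_complex_field:
  assumes "length Ks = length Us"
  shows "complex_field.combine Ks Us = (\<Sum>i<length Us. Ks ! i * Us ! i)"
  using assms
  by (induction Ks Us rule: list_induct2) (simp_all add: lessThan_Suc_eq_insert_0 sum.reindex del: sum.lessThan_Suc)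

lemma alg_int_ring_ring_of_integers:
  assumes "cring (ring_of_integers K)"
  shows "alg_int_ring {x \<in> K. algebraic_int x}"
proof -
  interpret R: cring "ring_of_integers K" by fact
  show ?thesis
  proof
    fix x assume x: "x \<in> {x \<in> K. algebraic_int x}"
    then have "\<ominus>\<^bsub>ring_of_integers K\<^esub> x \<in> {x \<in> K. algebraic_int x}"
      using R.a_inv_closed[of x] by simp
    moreover have "\<ominus>\<^bsub>ring_of_integers K\<^esub> x + x = 0"
      using R.l_neg[of x] x by simp
    ultimately show "- x \<in> {x \<in> K. algebraic_int x}"
      by (metis eq_neg_iff_add_eq_0 minus_minus)
  qed (use R.one_closed R.a_closed R.m_closed in auto)
qed

lemma prime_over_ring_of_integers:
  assumes "primeideal P (ring_of_integers K)" "Factorial_Ring.prime p" "of_nat p \<in> P"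
  shows "prime_over {x \<in> K. algebraic_int x} P p"
proof -
  interpret primeideal P "ring_of_integers K" by fact
  interpret alg_int_ring "{x \<in> K. algebraic_int x}"
    by (rule alg_int_ring_ring_of_integers) (rule is_cring)
  show ?thesis
  proof
    show "1 \<notin> P"
      using one_imp_carrier I_notcarr by auto
    show "P \<subseteq> {x \<in> K. algebraic_int x}"
      using a_subset by simp
    show "x + y \<in> P" if "x \<in> P" "y \<in> P" for x y
      using additive_subgroup.a_closed[OF is_additive_subgroup that] by simp
    show "x * y \<in> P" if "x \<in> {x \<in> K. algebraic_int x}" "y \<in> P" for x y
      using I_l_closed[of y x] that by simp
    show "x \<in> P \<or> y \<in> P" if "x \<in> {x \<in> K. algebraic_int x}" "y \<in> {x \<in> K. algebraic_int x}" "x * y \<in> P" for x y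
      using I_prime[of x y] that by simp
  qed (use assms(2,3) in auto)
qed

lemma ideal_foldr_ideal_prod:
  assumes "cring R" "\<And>P. P \<in> set Ps \<Longrightarrow> ideal P R"
  shows "ideal (foldr (ideal_prod R) Ps (carrier R)) R"
proof -
  interpret cring R by fact
  show ?thesis using assms(2)
    by (induction Ps) (auto intro: oneideal ideal_prod_is_ideal)
qed

text \<open>Since \<open>p\<close> generates the product of the listed primes, this puts
  \<open>p\<close> into each of them.\<close>

lemma foldr_ideal_prod_subset:
  assumes "cring R" "\<And>P. P \<in> set Ps \<Longrightarrow> ideal P R" "P \<in> set Ps"
  shows "foldr (ideal_prod R) Ps (carrier R) \<subseteq> P"
proof -
  interpret cring R by fact
  show ?thesis using assms(2,3)
  proof (induction Ps)
    case (Cons P' Ps)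
    have "ideal (foldr (ideal_prod R) Ps (carrier R)) R"
      by (rule ideal_foldr_ideal_prod) (use Cons.prems is_cring in auto)
    then show ?case
      using ideal_prod_inter[of P' "foldr (ideal_prod R) Ps (carrier R)"] Cons by auto
  qed auto
qed

lemma prod_list_mem_foldr_ideal_prod:
  assumes "cring (ring_of_integers K)" "\<And>P. P \<in> set Ps \<Longrightarrow> x P \<in> P"
  shows "prod_list (map x Ps) \<in> foldr (ideal_prod (ring_of_integers K)) Ps (carrier (ring_of_integers K))"
proof -
  interpret cring "ring_of_integers K" by fact
  show ?thesis using assms(2)
  proof (induction Ps)
    case Nil
    show ?case using one_closed by simp
  next
    case (Cons P Ps)
    then show ?case using ideal_prod.prod[of "x P" P "prod_list (map x Ps)" _ "ring_of_integers K"] by simp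
  qed
qed

text \<open>Clear denominators, then divide by the gcd. A linear relation over the rationals thereby
  becomes one with integer coefficients that is still nontrivial modulo \<open>p\<close>.\<close>

lemma rational_multiples_coprime_ints:
  fixes V :: "complex set"
  assumes "finite V" "V \<subseteq> (\<rat> :: complex set)" "\<not> V \<subseteq> {0}" "Factorial_Ring.prime (p :: int)"
  shows "\<exists>t g. (\<forall>x\<in>V. of_int (g x) = t * x) \<and> (\<exists>x\<in>V. \<not> p dvd g x)"
proof -
  have "\<exists>t::complex. t \<noteq> 0 \<and> (\<forall>x\<in>V. t * x \<in> \<int>)"
    using assms(1,2)
  proof (induction rule: finite_induct)
    case (insert x V)
    then obtain t where t: "t \<noteq> 0" "\<forall>x\<in>V. t * x \<in> \<int>" by auto
    obtain a b where ab: "b \<noteq> 0" "x = of_int a / of_int b"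
      using insert.prems by (metis Rats_cases' insert_subset less_irrefl)
    show ?case
    \<comment> \<open>The multiplier \<open>t\<close> from the induction is merely complex. A
      nonzero element of \<open>V\<close> forces it to be rational; if there is none,
      \<open>t\<close> is discarded and the denominator of \<open>x\<close> taken instead.\<close>
    proof (cases "V \<subseteq> {0}")
      case True
      then show ?thesis using ab by (intro exI[of _ "of_int b"]) auto
    next
      case False
      then obtain y where y: "y \<in> V" "y \<noteq> 0" by auto
      then have "y \<in> \<rat>" "t * y \<in> \<rat>" using insert.prems t Ints_subset_Rats by auto
      then have "t \<in> \<rat>" using y by (metis Rats_divide nonzero_mult_div_cancel_right)
      then obtain c d where cd: "d \<noteq> 0" "t = of_int c / of_int d" by (metis Rats_cases' less_irrefl)
      have "t * of_int d * of_int b * z \<in> \<int>" if "z \<in> insert x V" for z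
      proof (cases "z = x")
        case True
        have "t * of_int d * of_int b * z = of_int (c * a)"
          using True ab cd by simp
        then show ?thesis by (metis Ints_of_int)
      next
        case False
        then have "of_int d * of_int b * (t * z) \<in> \<int>"
          using that t by (auto simp del: of_int_mult intro!: Ints_mult[of "_ * _"])
        then show ?thesis by (simp add: mult_ac)
      qed
      then show ?thesis using t ab cd by (intro exI[of _ "t * of_int d * of_int b"]) auto
    qed
  qed (auto intro: exI[of _ 1])
  then obtain t where t: "t \<noteq> 0" "\<forall>x\<in>V. t * x \<in> \<int>" by blast
  then have "\<forall>x\<in>V. \<exists>a. of_int a = t * x" by (metis Ints_cases)
  then obtain a where a: "\<forall>x\<in>V. of_int (a x) = t * x" by metis
  define G where "G = Gcd (a ` V)"
  obtain x0 where "x0 \<in> V" "x0 \<noteq> 0" using assms by auto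
  then have "a x0 \<noteq> 0" using a t by (metis mult_eq_0_iff of_int_0)
  then have G0: "G \<noteq> 0" unfolding G_def using \<open>x0 \<in> V\<close> by (auto simp: Gcd_0_iff)
  have G: "a x = G * (a x div G)" if "x \<in> V" for x
    using that by (simp add: G_def)
  have "\<exists>x\<in>V. \<not> p dvd a x div G"
  proof (rule ccontr)
    assume "\<not> ?thesis"
    then have "G * p dvd a x" if "x \<in> V" for x
      using G[OF that] that by (metis mult_dvd_mono dvd_refl)
    then have "G * p dvd Gcd (a ` V)" by (intro Gcd_greatest) auto
    then have "G * p dvd G * 1" by (simp add: G_def)
    then have "p dvd 1" using G0 by (simp only: dvd_mult_cancel_left simp_thms)
    then show False using assms(4) by (simp add: not_prime_unit)
  qed
  moreover have "of_int (a x div G) = t / of_int G * x" if "x \<in> V" for x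
  proof -
    have "of_int G * of_int (a x div G) = t * x"
      using G[OF that] a that by (metis of_int_mult)
    then show ?thesis using G0 by (simp add: field_simps)
  qed
  ultimately show ?thesis
    by (intro exI[of _ "t / of_int G"] exI[of _ "\<lambda>x. a x div G"]) auto
qed

text \<open>
  If \<open>y\<close> were not congruent to an integer modulo \<open>P 0\<close>, the \<open>d + 1\<close> numbers
  \<open>y * e 0, e 0, \<dots>, e (d - 1)\<close> would be independent modulo \<open>p\<close>, hence over \<open>\<rat>\<close>.
\<close>

lemma residue_degree_one:
  fixes P :: "nat \<Rightarrow> complex set" and e :: "nat \<Rightarrow> complex"
  assumes P: "\<And>i. i < d \<Longrightarrow> prime_over A (P i) p"
    and d: "0 < d"
    and dim: "complex_field.dimension d \<rat> K" and AK: "A \<subseteq> K"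
    and eA: "\<And>i. i < d \<Longrightarrow> e i \<in> A"
    and e1: "\<And>i. i < d \<Longrightarrow> e i \<notin> P i"
    and e2: "\<And>i j. i < d \<Longrightarrow> j < d \<Longrightarrow> i \<noteq> j \<Longrightarrow> e i \<in> P j"
    and y: "y \<in> A"
  shows "\<exists>a::int. y - of_int a \<in> P 0"
proof -
  interpret P0: prime_over A "P 0" p by (rule P[OF d])
  define Us where "Us = y * e 0 # map e [0..<d]"
  have "length Us = Suc d" by (simp add: Us_def)
  have "set Us \<subseteq> K"
    using AK eA d y P0.mult_mem by (auto simp: Us_def)
  then have "\<not> complex_field.independent \<rat> Us"
    using complex_field.independent_length_le_dimension[OF subfield_Rats dim] \<open>length Us = Suc d\<close>
    by fastforce
  then obtain Ks where Ks: "length Ks = length Us" "complex_field.combine Ks Us = 0"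
    "set Ks \<subseteq> (\<rat> :: complex set)" "set Ks \<noteq> {0}"
    using complex_field.dependent_imp_non_trivial_combine[OF subfield_Rats, of Us] by auto
  have "Ks \<noteq> []" using Ks(1) by (auto simp: Us_def)
  then have "\<not> set Ks \<subseteq> {0}" using Ks(4) by (auto simp: subset_singleton_iff)
  then obtain t g where g: "\<forall>x\<in>set Ks. of_int (g x) = t * x" "\<exists>x\<in>set Ks. \<not> int p dvd g x"
    using rational_multiples_coprime_ints[of "set Ks" "int p"] Ks(3) P0.prime_int_p by auto
  define b where "b i = g (Ks ! i)" for i
  have "(\<Sum>i<Suc d. of_int (b i) * Us ! i) = t * (\<Sum>i<Suc d. Ks ! i * Us ! i)"
    unfolding sum_distrib_left using g(1) Ks(1) \<open>length Us = Suc d\<close>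
    by (intro sum.cong) (auto simp: b_def)
  also have "\<dots> = 0"
    using Ks(2) combine_complex_field[OF Ks(1)] \<open>length Us = Suc d\<close> by simp
  finally have "of_int (b 0) * (y * e 0) + (\<Sum>i<d. of_int (b (Suc i)) * e i) = 0"
    by (simp add: Us_def lessThan_Suc_eq_insert_0 sum.reindex del: sum.lessThan_Suc)
  then have rel: "of_int (b 0) * (y * e 0) + (of_int (b (Suc j)) * e j +
      (\<Sum>i\<in>{..<d}-{j}. of_int (b (Suc i)) * e i)) = 0" if "j < d" for j
    using that by (subst (asm) sum.remove[of _ j]) auto
  have rest: "(\<Sum>i\<in>{..<d}-{j}. of_int (b (Suc i)) * e i) \<in> P j" if "j < d" for j
  proof -
    interpret prime_over A "P j" p by (rule P[OF that])
    show ?thesis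
      using that e2 by (intro P_sum P_mult P0.of_int_mem) auto
  qed
  \<comment> \<open>Modulo \<open>P j\<close> every term of the relation vanishes except that of
    \<open>e j\<close>, including \<open>y * e 0\<close> because \<open>j\<close> is not 0. As
    \<open>e j\<close> is outside \<open>P j\<close>, its coefficient is divisible by
    \<open>p\<close>.\<close>
  have b_dvd: "int p dvd b (Suc j)" if "0 < j" "j < d" for j
  proof -
    interpret prime_over A "P j" p by (rule P[OF that(2)])
    have "of_int (b 0) * (y * e 0) + (\<Sum>i\<in>{..<d}-{j}. of_int (b (Suc i)) * e i) \<in> P j"
      using that d e2[of 0 j] y rest by (intro P_add P_mult P0.of_int_mem) auto
    then have "- (of_int (b (Suc j)) * e j) \<in> P j"
      using rel[OF that(2)] by (metis add.left_commute add_eq_0_iff minus_minus)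
    then have "of_int (b (Suc j)) * e j \<in> P j"
      using P_minus by fastforce
    then show ?thesis
      using P_prime[OF P0.of_int_mem eA] e1 that int_mem_P_iff by blast
  qed
  have "of_int (b 0) * (y * e 0) + of_int (b (Suc 0)) * e 0
      = - (\<Sum>i\<in>{..<d}-{0}. of_int (b (Suc i)) * e i)"
    using rel[OF d] by (simp add: add_eq_0_iff2 flip: add.assoc)
  then have "(of_int (b 0) * y + of_int (b (Suc 0))) * e 0 \<in> P 0"
    using P0.P_minus[OF rest[OF d]] by (simp add: algebra_simps)
  moreover have "of_int (b 0) * y + of_int (b (Suc 0)) \<in> A"
    using y by (intro P0.add_mem P0.mult_mem P0.of_int_mem)
  ultimately have *: "of_int (b 0) * y + of_int (b (Suc 0)) \<in> P 0"
    using P0.P_prime eA e1 d by blast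
  \<comment> \<open>If \<open>p\<close> divided the coefficient of \<open>y * e 0\<close>, reduction
    modulo \<open>P 0\<close> would make it divide the coefficient of \<open>e 0\<close> too, hence
    all of them, contrary to the normalisation of the relation.\<close>
  have b0: "\<not> int p dvd b 0"
  proof
    assume dvd0: "int p dvd b 0"
    then have "of_int (b 0) * y \<in> P 0"
      using P0.P_mult2[OF _ y] P0.int_mem_P_iff by blast
    then have "of_int (b (Suc 0)) \<in> P 0"
      using P0.P_diff[OF *] by fastforce
    then have dvd1: "int p dvd b (Suc 0)" using P0.int_mem_P_iff by blast
    have "int p dvd b i" if "i < Suc d" for i
    proof (cases i)
      case (Suc j)
      then show ?thesis using dvd1 b_dvd[of j] that by (cases "j = 0") auto
    qed (use dvd0 in simp)
    then show False
      using g(2) Ks(1) \<open>length Us = Suc d\<close> by (metis b_def in_set_conv_nth)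
  qed
  obtain c where "int p dvd b 0 * c - 1"
    using P0.inverse_mod_p[OF b0] by blast
  then have c: "of_int (b 0 * c - 1) \<in> P 0"
    by (rule P0.int_mem_P_if_dvd)
  have "of_int c * (of_int (b 0) * y + of_int (b (Suc 0))) - of_int (b 0 * c - 1) * y \<in> P 0"
    using * c y by (intro P0.P_diff P0.P_mult P0.P_mult2 P0.of_int_mem)
  also have "of_int c * (of_int (b 0) * y + of_int (b (Suc 0))) - of_int (b 0 * c - 1) * y
      = y - of_int (- (c * b (Suc 0)))"
    by (simp add: algebra_simps)
  finally show ?thesis by blast
qed

text \<open>Any prime of the list serves, so the first is taken. The dual elements
  \<open>e P\<close> are products of elements separating \<open>P\<close> from each other prime; the
  one for \<open>P0\<close> doubles as \<open>q\<close>, because \<open>P0\<close> times the product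
  of the other primes is generated by \<open>p\<close>.\<close>

lemma splits_completely_split_prime:
  assumes "Factorial_Ring.prime p" "splits_completely p K" "1 \<in> K"
  shows "\<exists>P q. split_prime {x \<in> K. algebraic_int x} P p q"
proof -
  define A where "A = {x \<in> K. algebraic_int x}"
  define R where "R = ring_of_integers K"
  obtain Ps where Ps: "distinct Ps" "\<forall>P\<in>set Ps. primeideal P R"
    "complex_field.dimension (length Ps) \<rat> K"
    "foldr (ideal_prod R) Ps (carrier R) = PIdl\<^bsub>R\<^esub> (of_nat p)"
    using assms(2) by (auto simp: splits_completely_def R_def)
  \<comment> \<open>An empty list would mean dimension zero, which \<open>1 \<in> K\<close>
    excludes.\<close>
  have "Ps \<noteq> []"
  proof
    assume "Ps = []"
    then have "K = {0}" using complex_field.dimension_zero[OF subfield_Rats] Ps(3) by simp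
    then show False using assms(3) by simp
  qed
  then obtain P0 Qs where P0: "Ps = P0 # Qs" by (cases Ps) auto
  then interpret P0: primeideal P0 R using Ps by simp
  have R: "cring R" by (rule P0.is_cring)
  interpret A: alg_int_ring A
    using alg_int_ring_ring_of_integers R unfolding A_def R_def by blast
  have ideals: "ideal P R" if "P \<in> set Ps" for P
    using Ps(2) that by (simp add: primeideal.axioms(1))
  have PIdl: "PIdl\<^bsub>R\<^esub> (of_nat p) = {x * of_nat p | x. x \<in> A}"
    by (auto simp: cgenideal_def R_def A_def)
  have "of_nat p \<in> PIdl\<^bsub>R\<^esub> (of_nat p)"
    using A.one_mem unfolding PIdl by (auto intro!: exI[of _ 1])
  then have over: "prime_over A P p" if "P \<in> set Ps" for P
    using foldr_ideal_prod_subset[OF R ideals that] Ps(2,4) that prime_over_ring_of_integers assms(1)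
    unfolding A_def R_def by blast
  have "\<exists>x. \<forall>P\<in>set Ps. \<forall>P'\<in>set Ps. P' \<noteq> P \<longrightarrow> x P P' \<in> P' \<and> x P P' \<notin> P"
    using prime_over.not_subset_prime_over[OF over over] by metis
  then obtain x where x: "\<And>P P'. P \<in> set Ps \<Longrightarrow> P' \<in> set Ps \<Longrightarrow> P' \<noteq> P \<Longrightarrow> x P P' \<in> P' \<and> x P P' \<notin> P"
    by blast
  have xA: "x P P' \<in> A" if "P \<in> set Ps" "P' \<in> set Ps" "P' \<noteq> P" for P P'
    using x[OF that] prime_over.P_subset[OF over[OF that(2)]] by blast
  define e where "e P = (\<Prod>P'\<in>set Ps - {P}. x P P')" for P
  have eA: "e P \<in> A" if "P \<in> set Ps" for P
    unfolding e_def using xA that by (intro A.prod_mem) auto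
  have e1: "e P \<notin> P" if "P \<in> set Ps" for P
    unfolding e_def using xA x that by (intro prime_over.prod_notin_P[OF over[OF that]]) auto
  have e2: "e P \<in> P'" if "P \<in> set Ps" "P' \<in> set Ps" "P' \<noteq> P" for P P'
  proof -
    have "e P = x P P' * (\<Prod>Q\<in>set Ps - {P} - {P'}. x P Q)"
      unfolding e_def using that by (subst prod.remove[of _ P']) auto
    moreover have "(\<Prod>Q\<in>set Ps - {P} - {P'}. x P Q) \<in> A"
      using xA that by (intro A.prod_mem) auto
    ultimately show ?thesis
      using prime_over.P_mult2[OF over] x that by auto
  qed
  interpret prime_over A P0 p using over P0 by simp
  have residue: "\<exists>a::int. y - of_int a \<in> P0" if "y \<in> A" for y
  proof -
    have "\<exists>a::int. y - of_int a \<in> Ps ! 0"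
    proof (rule residue_degree_one[where d = "length Ps" and A = A and p = p and K = K and e = "\<lambda>i. e (Ps ! i)"])
      show "e (Ps ! i) \<in> Ps ! j" if "i < length Ps" "j < length Ps" "i \<noteq> j" for i j
        using e2 Ps(1) that by (simp add: nth_eq_iff_index_eq)
    qed (use that Ps(3) eA e1 over \<open>Ps \<noteq> []\<close> in \<open>auto simp: A_def\<close>)
    then show ?thesis by (simp add: P0)
  qed
  \<comment> \<open>The product is taken along the list so that it visibly lies in the ideal product
    over \<open>Qs\<close>; distinctness of the list identifies it with \<open>e P0\<close>.\<close>
  define q where "q = prod_list (map (x P0) Qs)"
  have q: "q = e P0"
    unfolding q_def e_def using Ps(1) P0 by (simp add: prod.distinct_set_conv_list)
  have "\<exists>z\<in>A. q * y = of_nat p * z" if "y \<in> P0" for y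
  proof -
    have "q \<in> foldr (ideal_prod R) Qs (carrier R)"
      unfolding q_def R_def
      by (rule prod_list_mem_foldr_ideal_prod) (use R x Ps(1) P0 in \<open>auto simp: R_def\<close>)
    then have "y \<otimes>\<^bsub>R\<^esub> q \<in> foldr (ideal_prod R) Ps (carrier R)"
      unfolding P0 using that by (auto intro: ideal_prod.prod)
    then have "y * q \<in> PIdl\<^bsub>R\<^esub> (of_nat p)"
      using Ps(4) by (simp add: R_def)
    then show ?thesis unfolding PIdl by (auto simp: mult.commute)
  qed
  then have "split_prime A P0 p q"
    using residue q eA e1 P0 by unfold_locales auto
  then show ?thesis unfolding A_def by blast
qed

section \<open>Approximation of the roots by integers\<close>

context split_prime
begin

lemma I_cong_mult:
  assumes "x \<in> A" "y' \<in> A" "x - x' \<in> I k" "y - y' \<in> I k"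
  shows "x * y - x' * y' \<in> I k"
proof -
  have "x * (y - y') + y' * (x - x') \<in> I k"
    using assms by (intro I_add I_absorb)
  then show ?thesis by (simp add: algebra_simps)
qed

lemma I_zero: "0 \<in> I k"
  using int_mem_I_iff[of 0 k] by simp

lemma I_cong_power:
  assumes "x \<in> A" "x' \<in> A" "x - x' \<in> I k"
  shows "x ^ m - x' ^ m \<in> I k"
  using assms by (induction m) (auto simp: I_zero intro: I_cong_mult power_mem)

lemma I_cong_prod:
  assumes "\<And>i. i \<in> J \<Longrightarrow> g i \<in> A \<and> h i \<in> A \<and> g i - h i \<in> I k"
  shows "prod g J - prod h J \<in> I k"
  using assms
  by (induction J rule: infinite_finite_induct) (auto simp: I_zero intro!: I_cong_mult prod_mem)

lemma coprime_power_p: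
  assumes "\<not> int p dvd c"
  shows "Rings.coprime c (int p ^ k)"
  using prime_imp_coprime[OF prime_int_p assms] by (simp add: Rings.coprime_commute)

text \<open>Here \<open>v\<close> is f, the \<open>\<beta> z\<close> are the roots scaled by
  \<open>c\<close>, and the factor \<open>c ^ n\<close> in \<open>eq\<close> keeps the factorisation
  among algebraic integers. For the upper bound, only the factor of the root nearest to
  \<open>x\<close> can be deep in the filtration; the remaining factors contribute at most
  \<open>C\<close>. For the lower bound, closeness to a root of multiplicity \<open>R\<close> counts
  \<open>R\<close> times.\<close>

lemma integer_approximations:
  fixes Z :: "complex set" and v :: "int \<Rightarrow> int" and R :: nat
  assumes fin: "finite Z" and beta: "\<And>z. z \<in> Z \<Longrightarrow> \<beta> z \<in> A" and inj: "inj_on \<beta> Z"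
    and c: "\<not> int p dvd c"
    and eq: "\<And>x. of_int (c ^ n * v x) = of_int c * (\<Prod>z\<in>Z. (of_int c * of_int x - \<beta> z) ^ m z)"
    and m: "\<And>z. z \<in> Z \<Longrightarrow> m z \<le> R" and z0: "z0 \<in> Z" "m z0 = R" and R: "0 < R"
  shows "\<exists>as C. finite as \<and> (\<forall>a\<in>as. \<forall>k. [a (Suc k) = a k] (mod int p ^ k)) \<and>
    (\<forall>x e. int p ^ e dvd v x \<longrightarrow> (\<exists>a\<in>as. \<exists>k. e \<le> R * k + C \<and> [x = a k] (mod int p ^ k))) \<and>
    (\<exists>a\<in>as. \<forall>k x. [x = a k] (mod int p ^ k) \<longrightarrow> int p ^ (R * k) dvd v x)"
proof -
  have "\<forall>z\<in>Z. \<forall>k. \<exists>r::int. \<beta> z - of_int r \<in> I k"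
    using I_residue beta by blast
  then obtain r :: "complex \<Rightarrow> nat \<Rightarrow> int" where r: "\<And>z k. z \<in> Z \<Longrightarrow> \<beta> z - of_int (r z k) \<in> I k"
    by metis
  have "\<forall>k. \<exists>c'. [c * c' = 1] (mod int p ^ k)"
    using cong_solve_coprime_int[OF coprime_power_p[OF c]] by blast
  then obtain c' where c': "\<And>k. [c * c' k = 1] (mod int p ^ k)"
    by metis
  \<comment> \<open>\<open>r z k\<close> approximates the scaled root, so dividing by
    \<open>c\<close> modulo \<open>p ^ k\<close> gives the residue of the root itself.\<close>
  define \<rho> where "\<rho> z k = c' k * r z k" for z k
  have approx1: "of_int c * of_int x - \<beta> z \<in> I k \<longleftrightarrow> int p ^ k dvd c * x - r z k" if "z \<in> Z" for x z k
  proof -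
    have "of_int c * of_int x - \<beta> z = of_int (c * x - r z k) - (\<beta> z - of_int (r z k))"
      by simp
    then show ?thesis
      using r[OF that, of k] I_diff I_add int_mem_I_iff by (metis diff_add_cancel)
  qed
  have approx2: "int p ^ k dvd c * x - r z k \<longleftrightarrow> [x = \<rho> z k] (mod int p ^ k)" for x z k
  proof -
    have "[c * \<rho> z k = 1 * r z k] (mod int p ^ k)"
      unfolding \<rho>_def mult.assoc[symmetric] by (rule cong_scalar_right[OF c'])
    then have "[c * x = r z k] (mod int p ^ k) \<longleftrightarrow> [c * x = c * \<rho> z k] (mod int p ^ k)"
      by (metis cong_sym cong_trans mult_1)
    also have "\<dots> \<longleftrightarrow> [x = \<rho> z k] (mod int p ^ k)"
      by (rule cong_mult_lcancel[OF coprime_power_p[OF c]])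
    finally show ?thesis by (simp add: cong_iff_dvd_diff)
  qed
  note approx = approx1[unfolded approx2]
  have coherent: "[\<rho> z (Suc k) = \<rho> z k] (mod int p ^ k)" if "z \<in> Z" for z k
  proof -
    have "of_int c * of_int (\<rho> z (Suc k)) - \<beta> z \<in> I (Suc k)"
      using approx[OF that] by simp
    then have "of_int c * of_int (\<rho> z (Suc k)) - \<beta> z \<in> I k"
      using I_antimono[of k "Suc k"] by auto
    then show ?thesis
      using approx[OF that] by simp
  qed
  have lower: "int p ^ (R * k) dvd v x" if "[x = \<rho> z0 k] (mod int p ^ k)" for k x
  proof -
    have mem: "of_int c * of_int x - \<beta> z \<in> A" if "z \<in> Z" for z
      using that by (intro diff_mem mult_mem of_int_mem beta)
    have "(of_int c * of_int x - \<beta> z0) ^ R \<in> I (R * k)"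
      using that approx z0 I_power by blast
    then have "of_int c * (\<Prod>z\<in>Z - {z0}. (of_int c * of_int x - \<beta> z) ^ m z) *
        (of_int c * of_int x - \<beta> z0) ^ R \<in> I (R * k)"
      using mem by (intro I_absorb mult_mem of_int_mem prod_mem power_mem) auto
    then have "of_int (c ^ n * v x) \<in> I (R * k)"
      unfolding eq using fin z0 by (subst prod.remove[of _ z0]) (auto simp: mult_ac)
    then have "int p ^ (R * k) dvd c ^ n * v x"
      by (simp only: int_mem_I_iff)
    moreover have "Rings.coprime (int p ^ (R * k)) (c ^ n)"
      using coprime_power_p[OF c] by (simp add: Rings.coprime_commute del: coprime_power_right_iff)
    ultimately show ?thesis
      by (simp add: coprime_dvd_mult_right_iff)
  qed
  have "\<forall>z\<in>Z. \<forall>z'\<in>Z. \<exists>k. z \<noteq> z' \<longrightarrow> \<beta> z - \<beta> z' \<notin> I k"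
  proof (intro ballI)
    fix z z' assume z: "z \<in> Z" "z' \<in> Z"
    show "\<exists>k. z \<noteq> z' \<longrightarrow> \<beta> z - \<beta> z' \<notin> I k"
    proof (cases "z = z'")
      case False
      then have "\<beta> z - \<beta> z' \<noteq> 0" using inj z by (auto simp: inj_on_def)
      then show ?thesis using I_separated diff_mem beta z by blast
    qed auto
  qed
  then obtain s where s: "\<And>z z'. z \<in> Z \<Longrightarrow> z' \<in> Z \<Longrightarrow> z \<noteq> z' \<Longrightarrow> \<beta> z - \<beta> z' \<notin> I (s z z')"
    by metis
  \<comment> \<open>A common level at which all roots are distinguished; the sum merely bounds each
    separation level.\<close>
  define N where "N = (\<Sum>(z, z')\<in>Z \<times> Z. s z z')"
  have N: "\<beta> z - \<beta> z' \<notin> I N" if "z \<in> Z" "z' \<in> Z" "z \<noteq> z'" for z z'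
  proof -
    have "s z z' \<le> N"
      unfolding N_def using member_le_sum[of "(z, z')" "Z \<times> Z" "\<lambda>(z, z'). s z z'"] that fin by auto
    then show ?thesis using s[OF that] I_antimono by blast
  qed
  define C where "C = (\<Sum>z\<in>Z. m z * N)"
  have upper: "\<exists>z\<in>Z. \<exists>k. e \<le> R * k + C \<and> [x = \<rho> z k] (mod int p ^ k)"
    if dvd: "int p ^ e dvd v x" for x e
  \<comment> \<open>If \<open>x\<close> is within \<open>p ^ e\<close> of some root,
    \<open>k = e\<close> already works since \<open>R\<close> is positive. Otherwise all
    \<open>a z\<close> below are nonzero with multiplicity less than \<open>e\<close>, so the
    approximation to precision \<open>e\<close> sees their exact multiplicities.\<close>
  proof (cases "\<exists>z\<in>Z. int p ^ e dvd c * x - r z e")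
    case True
    then show ?thesis using approx2 R by (metis mult_le_mono1 mult_1 Suc_leI One_nat_def trans_le_add1)
  next
    case False
    define a where "a z = c * x - r z e" for z
    have a: "\<not> int p ^ e dvd a z" if "z \<in> Z" for z
      using False that by (simp add: a_def)
    have "(\<Prod>z\<in>Z. (of_int c * of_int x - \<beta> z) ^ m z) - (\<Prod>z\<in>Z. of_int (a z) ^ m z) \<in> I e"
    proof (rule I_cong_prod)
      fix z assume z: "z \<in> Z"
      have "(of_int c * of_int x - \<beta> z) - of_int (a z) = - (\<beta> z - of_int (r z e))"
        by (simp add: a_def)
      then have "(of_int c * of_int x - \<beta> z) - of_int (a z) \<in> I e"
        using I_minus[OF r[OF z]] by (simp only:)
      moreover have "of_int c * of_int x - \<beta> z \<in> A"
        using z by (intro diff_mem mult_mem of_int_mem beta)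
      ultimately show "(of_int c * of_int x - \<beta> z) ^ m z \<in> A \<and> of_int (a z) ^ m z \<in> A \<and>
          (of_int c * of_int x - \<beta> z) ^ m z - of_int (a z) ^ m z \<in> I e"
        using I_cong_power power_mem of_int_mem by blast
    qed
    from I_absorb[OF of_int_mem this, of c]
    have "of_int (c ^ n * v x) - of_int (c * (\<Prod>z\<in>Z. a z ^ m z)) \<in> I e"
      unfolding eq by (simp add: algebra_simps)
    moreover have "of_int (c ^ n * v x) \<in> I e"
      using dvd by (subst int_mem_I_iff) auto
    ultimately have "of_int (c * (\<Prod>z\<in>Z. a z ^ m z)) \<in> I e"
      by (metis I_diff diff_diff_eq2 add_diff_cancel_left')
    then have "int p ^ e dvd c * (\<Prod>z\<in>Z. a z ^ m z)"
      by (simp only: int_mem_I_iff)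
    then have "int p ^ e dvd (\<Prod>z\<in>Z. a z ^ m z)"
      using coprime_power_p[OF c, of e]
      by (simp add: coprime_dvd_mult_right_iff Rings.coprime_commute del: coprime_power_right_iff)
    moreover have a0: "a z \<noteq> 0" if "z \<in> Z" for z
      using a[OF that] by auto
    ultimately have "e \<le> multiplicity (int p) (\<Prod>z\<in>Z. a z ^ m z)"
      using fin prime_int_p by (intro multiplicity_geI) (auto simp: not_prime_unit)
    also have "\<dots> = (\<Sum>z\<in>Z. m z * multiplicity (int p) (a z))"
      using fin a0 prime_int_p
      by (simp add: prime_elem_multiplicity_prod_distrib prime_elem_multiplicity_power_distrib image_iff)
    finally have e: "e \<le> (\<Sum>z\<in>Z. m z * multiplicity (int p) (a z))" .
    have k: "of_int c * of_int x - \<beta> z \<in> I (multiplicity (int p) (a z))" if "z \<in> Z" for z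
    proof -
      have "multiplicity (int p) (a z) \<le> e"
        using a[OF that] multiplicity_dvd' nat_le_linear by blast
      then have "\<beta> z - of_int (r z e) \<in> I (multiplicity (int p) (a z))"
        using r[OF that] I_antimono by blast
      moreover have "of_int (a z) \<in> I (multiplicity (int p) (a z))"
        by (subst int_mem_I_iff) (rule multiplicity_dvd)
      ultimately have "of_int (a z) - (\<beta> z - of_int (r z e)) \<in> I (multiplicity (int p) (a z))"
        by (rule I_diff[rotated])
      then show ?thesis by (simp add: a_def)
    qed
    \<comment> \<open>The root nearest to \<open>x\<close>. If another root were closer than level
      \<open>N\<close> as well, the difference of the two scaled roots would lie in
      \<open>I N\<close>.\<close>
    obtain z1 where z1: "z1 \<in> Z" "\<And>z. z \<in> Z \<Longrightarrow> multiplicity (int p) (a z) \<le> multiplicity (int p) (a z1)"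
      using obtains_MAX[of Z "\<lambda>z. multiplicity (int p) (a z)"] fin z0
      by (metis (no_types, lifting) Max_ge empty_iff finite_imageI imageI)
    have "multiplicity (int p) (a z) \<le> N" if "z \<in> Z" "z \<noteq> z1" for z
    proof (rule ccontr)
      assume "\<not> multiplicity (int p) (a z) \<le> N"
      then have "of_int c * of_int x - \<beta> z \<in> I N" "of_int c * of_int x - \<beta> z1 \<in> I N"
        using k[OF that(1)] k[OF z1(1)] z1(2)[OF that(1)] I_antimono
        by (meson le_trans nle_le subsetD)+
      then have "(of_int c * of_int x - \<beta> z1) - (of_int c * of_int x - \<beta> z) \<in> I N"
        by (rule I_diff[rotated])
      then show False using N[OF that(1) z1(1)] that by simp
    qed
    then have "(\<Sum>z\<in>Z - {z1}. m z * multiplicity (int p) (a z)) \<le> (\<Sum>z\<in>Z - {z1}. m z * N)"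
      by (intro sum_mono) auto
    also have "\<dots> \<le> C"
      unfolding C_def using fin by (intro sum_mono2) auto
    finally have "(\<Sum>z\<in>Z - {z1}. m z * multiplicity (int p) (a z)) \<le> C" .
    moreover have "m z1 * multiplicity (int p) (a z1) \<le> R * multiplicity (int p) (a z1)"
      using m z1 by auto
    moreover have "(\<Sum>z\<in>Z. m z * multiplicity (int p) (a z)) = m z1 * multiplicity (int p) (a z1) +
        (\<Sum>z\<in>Z - {z1}. m z * multiplicity (int p) (a z))"
      using fin z1(1) by (rule sum.remove)
    ultimately have "e \<le> R * multiplicity (int p) (a z1) + C"
      using e by linarith
    then show ?thesis
      using k[OF z1(1)] approx[OF z1(1)] z1(1) by blast
  qed
  have "\<exists>a\<in>\<rho> ` Z. \<forall>k x. [x = a k] (mod int p ^ k) \<longrightarrow> int p ^ (R * k) dvd v x"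
    using lower z0(1) by blast
  moreover have "\<forall>x e. int p ^ e dvd v x \<longrightarrow> (\<exists>a\<in>\<rho> ` Z. \<exists>k. e \<le> R * k + C \<and> [x = a k] (mod int p ^ k))"
    using upper by blast
  moreover have "\<forall>a\<in>\<rho> ` Z. \<forall>k. [a (Suc k) = a k] (mod int p ^ k)"
    using coherent by blast
  ultimately show ?thesis
    using fin by blast
qed

end

text \<open>The polynomial \<open>g\<close> is chosen so that
  \<open>g(c z) = c ^ (n - 1) * f(z)\<close>; it is monic with integer coefficients.\<close>

lemma algebraic_int_lead_coeff_mult_root:
  fixes f :: "int poly" and z :: complex
  assumes "f \<noteq> 0" "poly (map_poly of_int f) z = 0"
  shows "algebraic_int (of_int (Polynomial.lead_coeff f) * z)"
proof -
  define n where "n = Polynomial.degree f"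
  define c where "c = Polynomial.lead_coeff f"
  have "n \<noteq> 0"
  proof
    assume "n = 0"
    then obtain a where "f = [:a:]" by (auto simp: n_def elim: degree_eq_zeroE)
    then show False using assms by (simp add: map_poly_pCons)
  qed
  define g :: "complex poly" where "g = Polynomial.monom 1 n +
    (\<Sum>i<n. Polynomial.monom (of_int (Polynomial.coeff f i * c ^ (n - 1 - i))) i)"
  have coeff_g: "Polynomial.coeff g i = (if i = n then 1 else 0) +
      (if i < n then of_int (Polynomial.coeff f i * c ^ (n - 1 - i)) else 0)" for i
    unfolding g_def by (simp add: coeff_sum)
  have "Polynomial.degree g = n"
  proof (rule antisym)
    show "Polynomial.degree g \<le> n" by (rule degree_le) (simp add: coeff_g)
    show "n \<le> Polynomial.degree g" by (rule le_degree) (simp add: coeff_g)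
  qed
  then have lead: "Polynomial.lead_coeff g = 1"
    by (simp add: coeff_g)
  have ints: "\<forall>i. Polynomial.coeff g i \<in> \<int>"
    by (auto simp: coeff_g)
  have "poly g (of_int c * z) = (of_int c * z) ^ n +
      (\<Sum>i<n. of_int (Polynomial.coeff f i * c ^ (n - 1 - i)) * (of_int c * z) ^ i)"
    unfolding g_def by (simp add: poly_monom poly_sum)
  also have "(\<Sum>i<n. of_int (Polynomial.coeff f i * c ^ (n - 1 - i)) * (of_int c * z) ^ i)
      = (\<Sum>i<n. of_int c ^ (n - 1) * (of_int (Polynomial.coeff f i) * z ^ i))"
  proof (rule sum.cong)
    fix i assume "i \<in> {..<n}"
    then have "of_int c ^ (n - 1) = (of_int c ^ (n - 1 - i) * of_int c ^ i :: complex)"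
      by (simp flip: power_add)
    then show "of_int (Polynomial.coeff f i * c ^ (n - 1 - i)) * (of_int c * z) ^ i
        = of_int c ^ (n - 1) * (of_int (Polynomial.coeff f i) * z ^ i)"
      by (simp add: power_mult_distrib)
  qed simp
  also have "(of_int c * z) ^ n = of_int c ^ (n - 1) * (of_int c * z ^ n)"
    using \<open>n \<noteq> 0\<close> by (cases n) (simp_all add: power_mult_distrib)
  also have "of_int c ^ (n - 1) * (of_int c * z ^ n) + (\<Sum>i<n. of_int c ^ (n - 1) * (of_int (Polynomial.coeff f i) * z ^ i))
      = of_int c ^ (n - 1) * (\<Sum>i\<le>n. of_int (Polynomial.coeff f i) * z ^ i)"
    by (simp add: c_def n_def sum_distrib_left distrib_left flip: lessThan_Suc_atMost)
  also have "(\<Sum>i\<le>n. of_int (Polynomial.coeff f i) * z ^ i) = poly (map_poly of_int f) z"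
    by (simp add: poly_altdef degree_map_poly coeff_map_poly n_def)
  finally have "poly g (of_int c * z) = 0"
    using assms(2) by simp
  then show ?thesis
    using lead ints algebraic_int.intros unfolding c_def by blast
qed

text \<open>The multiplicities add up to the degree, so \<open>c ^ degree f\<close> supplies exactly
  one factor \<open>c\<close> to each linear factor.\<close>

lemma poly_eq_prod_roots:
  fixes f :: "int poly" and x :: int
  defines "F \<equiv> map_poly complex_of_int f" and "c \<equiv> Polynomial.lead_coeff f"
  assumes "f \<noteq> 0"
  shows "of_int (c ^ Polynomial.degree f * poly f x) =
    of_int c * (\<Prod>z | poly F z = 0. (of_int c * of_int x - of_int c * z) ^ Polynomial.order z F)"
proof -
  have F0: "F \<noteq> 0"
    using assms by (simp add: F_def map_poly_eq_0_iff)
  have degF: "Polynomial.degree F = Polynomial.degree f"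
    by (simp add: F_def degree_map_poly)
  have c: "Polynomial.lead_coeff F = of_int c"
    using degF by (simp add: F_def c_def coeff_map_poly)
  then have c0: "c \<noteq> 0"
    using assms by (simp add: c_def)
  have F: "F = Polynomial.smult (of_int c) (\<Prod>z | poly F z = 0. [:- z, 1:] ^ Polynomial.order z F)"
    using complex_poly_decompose[of F] c by simp
  have "Polynomial.degree F = (\<Sum>z | poly F z = 0. Polynomial.order z F)"
    by (subst F) (simp add: c0 degree_prod_eq_sum_degree degree_power_eq)
  then have "of_int (c ^ Polynomial.degree f) = (\<Prod>z | poly F z = 0. (of_int c :: complex) ^ Polynomial.order z F)"
    using degF by (simp add: power_sum)
  moreover have "of_int (poly f x) = of_int c * (\<Prod>z | poly F z = 0. (of_int x - z) ^ Polynomial.order z F)"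
  proof -
    have "of_int (poly f x) = poly F (of_int x)"
      unfolding F_def by (simp add: poly_altdef degree_map_poly coeff_map_poly)
    also have "\<dots> = of_int c * (\<Prod>z | poly F z = 0. (of_int x - z) ^ Polynomial.order z F)"
      by (subst F) (simp add: poly_prod)
    finally show ?thesis .
  qed
  moreover have "(\<Prod>z | poly F z = 0. (of_int c * of_int x - of_int c * z) ^ Polynomial.order z F) =
      (\<Prod>z | poly F z = 0. of_int c ^ Polynomial.order z F) *
      (\<Prod>z | poly F z = 0. (of_int x - z) ^ Polynomial.order z F)"
    by (simp only: right_diff_distrib[symmetric] power_mult_distrib prod.distrib)
  ultimately show ?thesis
    by simp
qed

lemma roots_mem_splitting_field:
  "poly (map_poly of_int f) z = 0 \<Longrightarrow> z \<in> splitting_field f"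
  unfolding splitting_field_def by (rule generate_field.incl) simp

lemma splitting_field_closed:
  shows "1 \<in> splitting_field f" "x \<in> splitting_field f \<Longrightarrow> of_int a * x \<in> splitting_field f"
proof -
  have "subring (splitting_field f) complex_field"
    unfolding splitting_field_def
    by (rule subfieldE(1)[OF field.generate_field_is_subfield[OF field_from_type_algebra]]) simp
  note alg = subringE[OF this]
  show one: "1 \<in> splitting_field f"
    using alg(3) by simp
  have add: "x + y \<in> splitting_field f" if "x \<in> splitting_field f" "y \<in> splitting_field f" for x y
    using alg(7)[of x y] that by simp
  have minus: "- x \<in> splitting_field f" if "x \<in> splitting_field f" for x
    using alg(5)[of x] that by simp
  have "of_nat m * x \<in> splitting_field f" if "x \<in> splitting_field f" for m x
    using that add add[OF that minus[OF that]] by (induction m) (auto simp: distrib_right)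
  then show "of_int a * x \<in> splitting_field f" if "x \<in> splitting_field f"
    using that minus by (cases a rule: int_cases2) (auto simp flip: minus_mult_left)
qed

lemma max_root_multiplicity_eq:
  "max_root_multiplicity f = Max ((\<lambda>z. Polynomial.order z (map_poly of_int f)) ` {z :: complex. poly (map_poly of_int f) z = 0})"
  using roots_mem_splitting_field unfolding max_root_multiplicity_def
  by (metis (no_types, lifting) Collect_cong)

text \<open>
  The sequences in \<open>as\<close> stand for the \<open>p\<close>-adic roots of \<open>f\<close>, given by their residues modulo
  \<open>p\<^sup>k\<close>.
\<close>

lemma splits_completely_approximations:
  assumes p: "Factorial_Ring.prime p" "splits_completely p (splitting_field f)"
      "\<not> int p dvd Polynomial.lead_coeff f"
    and deg: "0 < Polynomial.degree f"
  defines "R \<equiv> max_root_multiplicity f"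
  shows "\<exists>as C. finite as \<and> (\<forall>a\<in>as. \<forall>k. [a (Suc k) = a k] (mod int p ^ k)) \<and>
    (\<forall>x e. int p ^ e dvd poly f x \<longrightarrow> (\<exists>a\<in>as. \<exists>k. e \<le> R * k + C \<and> [x = a k] (mod int p ^ k))) \<and>
    (\<exists>a\<in>as. \<forall>k x. [x = a k] (mod int p ^ k) \<longrightarrow> int p ^ (R * k) dvd poly f x)"
proof -
  have f0: "f \<noteq> 0" using deg by auto
  define F where "F = map_poly complex_of_int f"
  define c where "c = Polynomial.lead_coeff f"
  define Z where "Z = {z. poly F z = 0}"
  have F0: "F \<noteq> 0"
    using f0 by (simp add: F_def map_poly_eq_0_iff)
  have fin: "finite Z"
    unfolding Z_def by (rule poly_roots_finite[OF F0])
  obtain P q where "split_prime {x \<in> splitting_field f. algebraic_int x} P p q"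
    using splits_completely_split_prime[OF p(1,2) splitting_field_closed(1)] by blast
  then interpret split_prime "{x \<in> splitting_field f. algebraic_int x}" P p q .
  \<comment> \<open>A root must exist before \<open>R\<close>, a maximum over the roots, is known to
    be attained.\<close>
  have "\<not> constant (poly F)"
    using deg by (simp add: constant_degree F_def degree_map_poly)
  then obtain z where z: "z \<in> Z"
    unfolding Z_def using fundamental_theorem_of_algebra by blast
  have R_eq: "R = Max ((\<lambda>z. Polynomial.order z F) ` Z)"
    unfolding R_def max_root_multiplicity_eq F_def Z_def ..
  have "R \<in> (\<lambda>z. Polynomial.order z F) ` Z"
    unfolding R_eq using fin z by (intro Max_in) auto
  then obtain z0 where z0: "z0 \<in> Z" "Polynomial.order z0 F = R"
    by auto
  have le: "Polynomial.order z F \<le> R" if "z \<in> Z" for z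
    unfolding R_eq using fin that by (intro Max_ge) auto
  have "0 < R"
    using z0 F0 order_root[of F z0] by (simp add: Z_def)
  show ?thesis
  proof (rule integer_approximations[where Z = Z and c = c and \<beta> = "\<lambda>z. of_int c * z"
        and m = "\<lambda>z. Polynomial.order z F" and n = "Polynomial.degree f" and ?z0.0 = z0])
    show "of_int c * z \<in> {x \<in> splitting_field f. algebraic_int x}" if "z \<in> Z" for z
    proof -
      have "poly (map_poly of_int f) z = 0"
        using that by (simp add: Z_def F_def)
      then have "z \<in> splitting_field f" "algebraic_int (of_int c * z)"
        unfolding c_def
        by (rule roots_mem_splitting_field, rule algebraic_int_lead_coeff_mult_root[OF f0])
      then show ?thesis
        using splitting_field_closed(2) by simp
    qed
    show "inj_on (\<lambda>z. of_int c * z) Z"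
      using f0 by (auto simp: inj_on_def c_def)
    show "finite Z" "z0 \<in> Z" "Polynomial.order z0 F = R" "0 < R"
      by fact+
    show "Polynomial.order z F \<le> R" if "z \<in> Z" for z
      using le that .
    show "\<not> int p dvd c"
      using p(3) by (simp add: c_def)
    show "of_int (c ^ Polynomial.degree f * poly f x) =
        of_int c * (\<Prod>z\<in>Z. (of_int c * of_int x - of_int c * z) ^ Polynomial.order z F)" for x
      using poly_eq_prod_roots[OF f0, of x] unfolding c_def F_def Z_def .
  qed
qed

section \<open>Primes without \<open>p\<close>-adic root\<close>

lemma poly_cong_int:
  fixes f :: "int poly"
  assumes "[x = y] (mod m)"
  shows "[poly f x = poly f y] (mod m)"
  using assms by (induction f) (auto intro: cong_add cong_mult)

section \<open>Levelwise arithmetic in \<open>padic_ints\<close>\<close>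

context
  fixes p :: nat
  assumes p: "p > 0"
begin

interpretation padic: cring "padic_ints p"
  by (rule cring_padic_ints[OF p])

lemma padic_ints_mod: "x \<in> carrier (padic_ints p) \<Longrightarrow> x k mod int p ^ k = x k"
  by (simp add: padic_ints_def)

lemma padic_ints_add: "(x \<oplus>\<^bsub>padic_ints p\<^esub> y) k = (x k + y k) mod int p ^ k"
  by (simp add: padic_ints_def)

lemma padic_ints_uminus:
  assumes "x \<in> carrier (padic_ints p)"
  shows "(\<ominus>\<^bsub>padic_ints p\<^esub> x) k = (- x k) mod int p ^ k"
proof -
  have "(x \<oplus>\<^bsub>padic_ints p\<^esub> (\<ominus>\<^bsub>padic_ints p\<^esub> x)) k = 0"
    using padic.r_neg[OF assms] by (simp add: padic_ints_def)
  then have "[x k + (\<ominus>\<^bsub>padic_ints p\<^esub> x) k = 0] (mod int p ^ k)"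
    by (simp add: padic_ints_add unique_euclidean_semiring_class.cong_def)
  then have "[(\<ominus>\<^bsub>padic_ints p\<^esub> x) k = - x k] (mod int p ^ k)"
    by (simp add: cong_iff_dvd_diff add.commute)
  then show ?thesis
    using padic_ints_mod[OF padic.a_inv_closed[OF assms], of k] by (simp add: unique_euclidean_semiring_class.cong_def)
qed

lemma padic_ints_pow:
  assumes "x \<in> carrier (padic_ints p)"
  shows "(x [^]\<^bsub>padic_ints p\<^esub> (i::nat)) k = x k ^ i mod int p ^ k"
proof (induction i)
  case (Suc i)
  have "(x [^]\<^bsub>padic_ints p\<^esub> Suc i) k = ((x [^]\<^bsub>padic_ints p\<^esub> i) k * x k) mod int p ^ k"
    by (simp add: padic_ints_def)
  then show ?case by (simp add: Suc mod_simps mult.commute)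
qed (simp add: padic_ints_def)

lemma padic_ints_nat_scale:
  assumes "x \<in> carrier (padic_ints p)"
  shows "add_pow (padic_ints p) (m::nat) x k = int m * x k mod int p ^ k"
proof (induction m)
  case 0
  show ?case by (simp add: padic_ints_def add_pow_def nat_pow_def)
next
  case (Suc m)
  have "add_pow (padic_ints p) (Suc m) x k = (add_pow (padic_ints p) m x k + x k) mod int p ^ k"
    using assms by (simp add: padic_ints_add)
  then show ?case by (simp add: Suc mod_simps algebra_simps)
qed

lemma padic_ints_int_scale:
  assumes "x \<in> carrier (padic_ints p)"
  shows "add_pow (padic_ints p) (c::int) x k = c * x k mod int p ^ k"
proof (cases "c < 0")
  case True
  have closed: "add_pow (padic_ints p) (nat (- c)) x \<in> carrier (padic_ints p)"
    using assms by simp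
  have "add_pow (padic_ints p) c x = \<ominus>\<^bsub>padic_ints p\<^esub> add_pow (padic_ints p) (nat (- c)) x"
    using True by (simp only: add_pow_def a_inv_def int_pow_def2 if_True)
  then have "add_pow (padic_ints p) c x k = - add_pow (padic_ints p) (nat (- c)) x k mod int p ^ k"
    using padic_ints_uminus[OF closed] by simp
  then show ?thesis
    using True by (simp add: padic_ints_nat_scale[OF assms] mod_simps)
next
  case False
  then have "add_pow (padic_ints p) c x = add_pow (padic_ints p) (nat c) x"
    by (simp only: add_pow_def int_pow_def2 if_False)
  then show ?thesis
    using False padic_ints_nat_scale[OF assms, of "nat c"] by simp
qed

text \<open>Reduction modulo \<open>p ^ k\<close> respects sums and products, so a p-adic root is
  the same as a coherent sequence of roots modulo all \<open>p ^ k\<close>.\<close>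

lemma eval_int_poly_padic_ints:
  assumes x: "x \<in> carrier (padic_ints p)"
  shows "eval_int_poly (padic_ints p) f x k = poly f (x k) mod int p ^ k"
proof -
  define g where "g i = [Polynomial.coeff f i] \<cdot>\<^bsub>padic_ints p\<^esub> (x [^]\<^bsub>padic_ints p\<^esub> i)" for i
  have g: "g \<in> UNIV \<rightarrow> carrier (padic_ints p)"
    using x by (auto simp: g_def)
  have g_eq: "g i k = Polynomial.coeff f i * x k ^ i mod int p ^ k" for i
    unfolding g_def using x by (simp add: padic_ints_int_scale padic_ints_pow mod_simps)
  have "(\<Oplus>\<^bsub>padic_ints p\<^esub>i\<in>{..n}. g i) k = (\<Sum>i\<le>n. Polynomial.coeff f i * x k ^ i) mod int p ^ k" for n
  proof (induction n)
    case 0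
    have "(\<Oplus>\<^bsub>padic_ints p\<^esub>i\<in>{..0}. g i) = g 0"
      using g by (subst padic.finsum_0) auto
    then show ?case using g_eq[of 0] by simp
  next
    case (Suc n)
    have "(\<Oplus>\<^bsub>padic_ints p\<^esub>i\<in>{..Suc n}. g i) = g (Suc n) \<oplus>\<^bsub>padic_ints p\<^esub> (\<Oplus>\<^bsub>padic_ints p\<^esub>i\<in>{..n}. g i)"
      using g by (intro padic.finsum_Suc) auto
    then show ?case
      by (simp add: padic_ints_add Suc g_eq mod_simps add.commute)
  qed
  then show ?thesis
    by (simp add: eval_int_poly_def g_def poly_altdef)
qed

text \<open>Compactness in the form of Koenig's lemma: were the exponents unbounded, nested residue
  classes could be chosen, each met infinitely often by integers with ever more divisible values,
  and their limit would be a p-adic root.\<close>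

lemma multiplicity_bounded_if_no_padic_root:
  assumes "\<not> has_padic_int_root f p"
  shows "\<exists>C. \<forall>x e. int p ^ e dvd poly f x \<longrightarrow> e \<le> C"
proof (rule ccontr)
  assume contra: "\<not> (\<exists>C. \<forall>x e. int p ^ e dvd poly f x \<longrightarrow> e \<le> C)"
  have "\<exists>x. int p ^ e dvd poly f x" for e
    using contra by (metis dvd_trans le_imp_power_dvd nle_le)
  then obtain x where x: "\<And>e. int p ^ e dvd poly f (x e)"
    by metis
  \<comment> \<open>Indices are counted, not values: the \<open>x e\<close> may all coincide, for
    instance at an integer root of \<open>f\<close>.\<close>
  define good where "good k r \<longleftrightarrow> infinite {e. x e mod int p ^ k = r}" for k r
  have "\<exists>r. \<forall>k. good k (r k) \<and> r (Suc k) mod int p ^ k = r k"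
  proof (rule dependent_nat_choice)
    show "\<exists>r. good 0 r" by (auto simp: good_def)
  next
    fix r k assume "good k r"
    then have inf: "infinite {e. x e mod int p ^ k = r}"
      by (simp add: good_def)
    have "(\<lambda>e. x e mod int p ^ Suc k) ` {e. x e mod int p ^ k = r} \<subseteq> {0..<int p ^ Suc k}"
      using p by auto
    then obtain e0 where "e0 \<in> {e. x e mod int p ^ k = r}"
      "infinite {e \<in> {e. x e mod int p ^ k = r}. x e mod int p ^ Suc k = x e0 mod int p ^ Suc k}"
      using pigeonhole_infinite[OF inf] finite_subset[OF _ finite_atLeastLessThan_int] by blast
    then have "good (Suc k) (x e0 mod int p ^ Suc k)" "x e0 mod int p ^ k = r"
      unfolding good_def by (auto elim!: rev_finite_subset simp del: power_Suc)
    then show "\<exists>r'. good (Suc k) r' \<and> r' mod int p ^ k = r"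
      by (intro exI[of _ "x e0 mod int p ^ Suc k"]) (auto simp: mod_mod_cancel)
  qed
  then obtain r where r: "\<And>k. good k (r k)" "\<And>k. r (Suc k) mod int p ^ k = r k"
    by blast
  have ex: "\<exists>e\<ge>k. x e mod int p ^ k = r k" for k
    using r(1)[of k] unfolding good_def infinite_nat_iff_unbounded_le by blast
  have "r k \<in> {0..<int p ^ k}" for k
    using ex[of k] p by (metis atLeastLessThan_iff of_nat_0_less_iff pos_mod_bound pos_mod_sign zero_less_power)
  then have carr: "r \<in> carrier (padic_ints p)"
    using r(2) by (simp add: padic_ints_def)
  have "int p ^ k dvd poly f (r k)" for k
  proof -
    obtain e where e: "e \<ge> k" "x e mod int p ^ k = r k"
      using ex by blast
    then have "[r k = x e] (mod int p ^ k)"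
      by (simp add: unique_euclidean_semiring_class.cong_def flip: e(2))
    then have "[poly f (r k) = poly f (x e)] (mod int p ^ k)"
      by (rule poly_cong_int)
    moreover have "int p ^ k dvd poly f (x e)"
      using x[of e] e(1) by (metis dvd_trans le_imp_power_dvd)
    ultimately show ?thesis by (simp add: cong_dvd_iff)
  qed
  then have "eval_int_poly (padic_ints p) f r = \<zero>\<^bsub>padic_ints p\<^esub>"
    using eval_int_poly_padic_ints[OF carr] by (auto simp: padic_ints_def fun_eq_iff)
  then show False
    using assms carr by (auto simp: has_padic_int_root_def)
qed

end

section \<open>Counting products of prime powers\<close>

locale prime_set =
  fixes Q :: "nat set" and M :: nat
  assumes finite_Q: "finite Q" and Q_nonempty: "Q \<noteq> {}"
    and prime_Q: "p \<in> Q \<Longrightarrow> Factorial_Ring.prime p" and Q_le: "p \<in> Q \<Longrightarrow> p \<le> M"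
begin

definition H :: "(nat \<Rightarrow> nat) \<Rightarrow> nat" where
  "H k = (\<Prod>p\<in>Q. p ^ k p)"

text \<open>The window has ratio \<open>M\<close> because changing one exponent by one changes
  \<open>H\<close> by a factor of at most \<open>M\<close>, so no such step can jump across it.
  Extensionality makes a vector determined by its values on \<open>Q\<close>.\<close>

definition exps :: "real \<Rightarrow> (nat \<Rightarrow> nat) set" where
  "exps T = {k \<in> Q \<rightarrow>\<^sub>E UNIV. T \<le> real (H k) \<and> real (H k) < T * real M}"

lemma Q_ge_2: "p \<in> Q \<Longrightarrow> 2 \<le> p"
  using prime_Q prime_ge_2_nat by blast

lemma M_ge_2: "2 \<le> M"
  using Q_nonempty Q_ge_2 Q_le by fastforce

lemma H_pos: "0 < H k"
  unfolding H_def using Q_ge_2 by (intro prod_pos) fastforce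

lemma H_remove: "p \<in> Q \<Longrightarrow> H k = p ^ k p * (\<Prod>q\<in>Q - {p}. q ^ k q)"
  unfolding H_def using finite_Q by (rule prod.remove)

lemma power_dvd_H: "p \<in> Q \<Longrightarrow> p ^ k p dvd H k"
  by (simp add: H_remove)

lemma exp_le_if_H_less:
  assumes "p \<in> Q" "H k < 2 ^ L"
  shows "k p \<le> L"
proof -
  have "2 ^ k p \<le> p ^ k p" using Q_ge_2[OF assms(1)] by (rule power_mono) simp
  also have "\<dots> \<le> H k" using power_dvd_H[OF assms(1)] H_pos by (rule dvd_imp_le)
  also have "\<dots> < 2 ^ L" by fact
  finally show ?thesis by simp
qed

text \<open>Once the exponents of all primes but one are chosen, fewer than \<open>M\<close> values remain for the last.\<close>

lemma card_exps_le:
  assumes T: "0 < T" "T * real M \<le> 2 ^ L"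
  shows "finite (exps T)" "card (exps T) \<le> (L + 1) ^ (card Q - 1) * M"
proof -
  obtain p where p: "p \<in> Q" using Q_nonempty by blast
  define G where "G = (Q - {p}) \<rightarrow>\<^sub>E {..L}"
  define fiber where "fiber g = {k \<in> exps T. restrict k (Q - {p}) = g}" for g
  have le: "k q \<le> L" if "k \<in> exps T" "q \<in> Q" for k q
  proof (rule exp_le_if_H_less[of q k L])
    have "real (H k) < T * real M" using that(1) by (simp add: exps_def)
    then have "real (H k) < 2 ^ L" using T(2) by (rule less_le_trans)
    then show "H k < 2 ^ L" by simp
  qed fact
  have "exps T \<subseteq> Q \<rightarrow>\<^sub>E {..L}"
  proof
    fix k assume "k \<in> exps T"
    then show "k \<in> Q \<rightarrow>\<^sub>E {..L}" using le[of k] by (simp add: exps_def PiE_iff)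
  qed
  then show fin: "finite (exps T)"
    by (rule finite_subset) (intro finite_PiE[OF finite_Q], auto)
  have finG: "finite G"
    unfolding G_def using finite_Q by (intro finite_PiE) auto
  have cover: "exps T = (\<Union>g\<in>G. fiber g)"
    using le by (auto simp: fiber_def G_def)
  have fiber: "card (fiber g) \<le> M" for g
  proof (cases "fiber g = {}")
    case False
    define J where "J = (\<lambda>k. k p) ` fiber g"
    have "inj_on (\<lambda>k. k p) (fiber g)"
    proof (rule inj_onI, rule ext)
      fix k k' q assume k: "k \<in> fiber g" "k' \<in> fiber g" "k p = k' p"
      then have "restrict k (Q - {p}) q = restrict k' (Q - {p}) q" by (simp add: fiber_def)
      then show "k q = k' q"
        using k by (cases "q = p"; cases "q \<in> Q") (auto simp: fiber_def exps_def PiE_iff extensional_def)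
    qed
    then have "card (fiber g) = card J"
      unfolding J_def by (rule card_image[symmetric])
    moreover have finJ: "finite J" "J \<noteq> {}"
      unfolding J_def using False fin by (auto simp: fiber_def)
    moreover have "J \<subseteq> {Min J..<Min J + M}"
    \<comment> \<open>Within a fibre the quotient of two values of \<open>H\<close> is a power of
      \<open>p\<close>, and the window keeps it below \<open>M\<close>. Since
      \<open>i < p ^ i\<close>, the last exponents lie within \<open>M\<close> of the least
      one.\<close>
    proof
      fix j assume j: "j \<in> J"
      then have le_j: "Min J \<le> j" using finJ by simp
      obtain k where k: "k \<in> fiber g" "k p = j" using j by (auto simp: J_def)
      obtain k' where k': "k' \<in> fiber g" "k' p = Min J" using Min_in[OF finJ] by (auto simp: J_def)
      have same: "k q = k' q" if "q \<in> Q - {p}" for q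
        using k(1) k'(1) that unfolding fiber_def by (metis (mono_tags, lifting) mem_Collect_eq restrict_apply')
      have "(\<Prod>q\<in>Q - {p}. q ^ k q) = (\<Prod>q\<in>Q - {p}. q ^ k' q)"
        using same by (intro prod.cong) auto
      then have "H k = p ^ (j - Min J) * H k'"
        using k k' le_j by (simp add: H_remove[OF p] flip: power_add mult.assoc)
      then have "real (p ^ (j - Min J)) * T \<le> real (H k)"
        using k'(1) by (simp add: fiber_def exps_def mult_left_mono)
      also have "\<dots> < real M * T"
        using k(1) by (simp add: fiber_def exps_def mult.commute)
      finally have "p ^ (j - Min J) < M"
        using T(1) by (metis mult_less_cancel_right_pos of_nat_less_iff)
      moreover have "j - Min J < p ^ (j - Min J)"
        using Q_ge_2[OF p] by (intro power_gt_expt) auto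
      ultimately show "j \<in> {Min J..<Min J + M}" using le_j by auto
    qed
    ultimately show ?thesis
      by (metis add_diff_cancel_left' card_atLeastLessThan card_mono finite_atLeastLessThan)
  qed auto
  have "card (exps T) \<le> (\<Sum>g\<in>G. card (fiber g))"
    unfolding cover by (rule card_UN_le[OF finG])
  also have "\<dots> \<le> card G * M"
    using sum_bounded_above[of G "\<lambda>g. card (fiber g)" M] fiber by simp
  also have "card G = (L + 1) ^ (card Q - 1)"
    unfolding G_def using finite_Q p by (simp add: card_PiE card_Diff_singleton)
  finally show "card (exps T) \<le> (L + 1) ^ (card Q - 1) * M" .
qed

text \<open>The bound on \<open>L\<close> keeps the product over all primes but one at most
  \<open>T\<close>, whatever exponents up to \<open>L\<close> are chosen; raising the last exponent
  then reaches the window.\<close>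

lemma card_exps_ge:
  assumes T: "1 \<le> T" and L: "real M ^ (L * (card Q - 1)) \<le> T" and fin: "finite (exps T)"
  shows "(L + 1) ^ (card Q - 1) \<le> card (exps T)"
proof -
  obtain p where p: "p \<in> Q" using Q_nonempty by blast
  define G where "G = (Q - {p}) \<rightarrow>\<^sub>E {..L}"
  have "\<exists>k\<in>exps T. restrict k (Q - {p}) = g" if g: "g \<in> G" for g
  proof -
    define m where "m = (\<Prod>q\<in>Q - {p}. q ^ g q)"
    have "real m \<le> (\<Prod>q\<in>Q - {p}. real M ^ L)"
      unfolding m_def of_nat_prod
    proof (rule prod_mono, safe)
      fix q assume q: "q \<in> Q" "q \<noteq> p"
      have "real q ^ g q \<le> real M ^ g q"
        using Q_le[OF q(1)] by (intro power_mono) auto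
      also have "\<dots> \<le> real M ^ L"
        using M_ge_2 g q by (intro power_increasing) (auto simp: G_def PiE_iff)
      finally show "real (q ^ g q) \<le> real M ^ L" by simp
    qed simp
    also have "\<dots> = real M ^ (L * (card Q - 1))"
      using finite_Q p by (simp add: power_mult card_Diff_singleton)
    finally have m_le: "real m \<le> T" using L by linarith
    have m_pos: "0 < m"
      unfolding m_def using Q_ge_2 by (intro prod_pos) fastforce
    define j where "j = (LEAST j. T \<le> real (p ^ j * m))"
    have "\<exists>j. T \<le> real (p ^ j * m)"
    proof -
      obtain j where "T < 2 ^ j" using real_arch_pow[of 2 T] by auto
      also have "(2::real) ^ j \<le> real (p ^ j)"
        using Q_ge_2[OF p] by (simp add: power_mono)
      also have "\<dots> \<le> real (p ^ j * m)"
        using m_pos unfolding of_nat_le_iff by simp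
      finally show ?thesis by (intro exI[of _ j]) simp
    qed
    then have j: "T \<le> real (p ^ j * m)"
      unfolding j_def by (rule LeastI_ex)
    \<comment> \<open>The exponent is the least one reaching \<open>T\<close>, so the overshoot is
      less than a factor \<open>p\<close>; if it is 0, the product is at most \<open>T\<close>
      anyway.\<close>
    have j2: "real (p ^ j * m) < T * real M"
    proof (cases j)
      case 0
      have "T * 1 < T * real M" using T M_ge_2 by (intro mult_strict_left_mono) auto
      then show ?thesis using 0 m_le by simp
    next
      case (Suc i)
      have "\<not> T \<le> real (p ^ i * m)"
        using not_less_Least[of i "\<lambda>j. T \<le> real (p ^ j * m)"] Suc by (simp add: j_def)
      then have "real (p ^ i * m) * real p < T * real p"
        using Q_ge_2[OF p] by (intro mult_strict_right_mono) auto
      also have "\<dots> \<le> T * real M"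
        using T Q_le[OF p] by (intro mult_left_mono) auto
      finally show ?thesis by (simp add: Suc mult_ac)
    qed
    define k where "k = g(p := j)"
    have "(\<Prod>q\<in>Q - {p}. q ^ k q) = m"
      unfolding m_def by (intro prod.cong) (auto simp: k_def)
    then have "H k = p ^ j * m"
      by (simp add: H_remove[OF p] k_def)
    moreover have "k \<in> Q \<rightarrow>\<^sub>E UNIV"
      using g p by (auto simp: k_def G_def PiE_iff extensional_def)
    moreover have "restrict k (Q - {p}) = g"
      using g by (auto simp: k_def G_def PiE_iff extensional_def restrict_def)
    ultimately show ?thesis
      using j j2 by (intro bexI[of _ k]) (auto simp: exps_def)
  qed
  then have "G \<subseteq> (\<lambda>k. restrict k (Q - {p})) ` exps T" by blast
  then have "card G \<le> card (exps T)"
    using fin by (metis card_image_le card_mono finite_imageI le_trans)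
  moreover have "card G = (L + 1) ^ (card Q - 1)"
    unfolding G_def using finite_Q p by (simp add: card_PiE card_Diff_singleton)
  ultimately show ?thesis by simp
qed

text \<open>Remove one prime factor at a time until the window is hit. Closeness of order
  \<open>k\<close> implies closeness of every smaller order, so only the vectors in the window need
  counting.\<close>

lemma exps_below:
  assumes T: "1 \<le> T" and k: "k \<in> Q \<rightarrow>\<^sub>E UNIV" "T \<le> real (H k)"
  shows "\<exists>k'\<in>exps T. \<forall>p\<in>Q. k' p \<le> k p"
  using k
proof (induction "\<Sum>p\<in>Q. k p" arbitrary: k rule: less_induct)
  case less
  show ?case
  proof (cases "real (H k) < T * real M")
    case True
    then show ?thesis using less.prems by (auto simp: exps_def)
  next
    case False
    have "1 * 2 \<le> T * real M" using T M_ge_2 by (intro mult_mono) auto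
    then have "H k \<noteq> 1" using False by auto
    then obtain p where p: "p \<in> Q" "k p \<noteq> 0"
      by (metis H_def power_0 prod.neutral)
    define k' where "k' = k(p := k p - 1)"
    have eq: "(\<Prod>q\<in>Q - {p}. q ^ k' q) = (\<Prod>q\<in>Q - {p}. q ^ k q)"
      by (intro prod.cong) (auto simp: k'_def)
    have "p ^ k p = p * p ^ k' p"
      using p(2) by (cases "k p") (simp_all add: k'_def)
    then have Hk: "H k = p * H k'"
      using eq by (simp add: H_remove[OF p(1)])
    have "T * real p \<le> T * real M"
      using T Q_le[OF p(1)] by (intro mult_left_mono) auto
    also have "\<dots> \<le> real (H k') * real p"
      using False Hk by (simp add: mult.commute)
    finally have ge: "T \<le> real (H k')"
      using Q_ge_2[OF p(1)] by simp
    have mem: "k' \<in> Q \<rightarrow>\<^sub>E UNIV"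
      using less.prems(1) p by (auto simp: k'_def PiE_iff extensional_def)
    have "(\<Sum>q\<in>Q. k' q) < (\<Sum>q\<in>Q. k q)"
      using finite_Q p by (intro sum_strict_mono_ex1) (auto simp: k'_def)
    from less.hyps[OF this mem ge] obtain k'' where k'': "k'' \<in> exps T" "\<forall>p\<in>Q. k'' p \<le> k' p"
      by blast
    have "k' q \<le> k q" for q by (simp add: k'_def)
    then show ?thesis using k'' by (meson le_trans)
  qed
qed

lemma H_dvd_iff: "int (H k) dvd x \<longleftrightarrow> (\<forall>p\<in>Q. int p ^ k p dvd x)"
proof
  assume "int (H k) dvd x"
  then show "\<forall>p\<in>Q. int p ^ k p dvd x"
    using power_dvd_H by (metis dvd_trans int_dvd_int_iff of_nat_power)
next
  have "finite P \<Longrightarrow> P \<subseteq> Q \<Longrightarrow> \<forall>p\<in>P. int p ^ k p dvd x \<Longrightarrow> (\<Prod>p\<in>P. int p ^ k p) dvd x" for P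
  proof (induction P rule: finite_induct)
    case (insert p P)
    have "Rings.coprime (int p ^ k p) (int q ^ k q)" if "q \<in> P" for q
    proof -
      have "Rings.coprime p q"
        using that insert prime_Q by (intro primes_coprime) auto
      then show ?thesis by (simp flip: of_nat_power)
    qed
    then have "Rings.coprime (int p ^ k p) (\<Prod>q\<in>P. int q ^ k q)"
      by (rule prod_coprime_right)
    then show ?case using insert by (simp add: divides_mult)
  qed auto
  then show "\<forall>p\<in>Q. int p ^ k p dvd x \<Longrightarrow> int (H k) dvd x"
    using finite_Q by (simp add: H_def)
qed

end

section \<open>Integers in a residue class\<close>

lemma card_cong_class_le:
  fixes V :: "int set"
  assumes V: "\<And>x. x \<in> V \<Longrightarrow> \<bar>real_of_int x\<bar> \<le> B" "\<And>x y. x \<in> V \<Longrightarrow> y \<in> V \<Longrightarrow> int m dvd x - y"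
    and m: "0 < m" and B: "0 \<le> B"
  shows "real (card V) \<le> 2 * B / real m + 1"
proof (cases "V = {}")
  case False
  have "V \<subseteq> {- \<lfloor>B\<rfloor>..\<lfloor>B\<rfloor>}"
    using V(1) by (auto simp: le_floor_iff abs_le_iff) (metis le_floor_iff minus_le_iff of_int_minus)
  then have fin: "finite V" by (rule finite_subset) simp
  define a where "a = Min V"
  have a: "a \<in> V" "\<And>x. x \<in> V \<Longrightarrow> a \<le> x"
    using fin False by (auto simp: a_def)
  define K where "K = \<lfloor>2 * B / real m\<rfloor>"
  have "card V \<le> card {0..K}"
  proof (rule card_inj_on_le)
    show "inj_on (\<lambda>x. (x - a) div int m) V"
    proof (rule inj_onI)
      fix x y assume "x \<in> V" "y \<in> V" "(x - a) div int m = (y - a) div int m"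
      then have "x - a = y - a" using V(2) a(1) by (metis dvd_div_mult_self)
      then show "x = y" by simp
    qed
    show "(\<lambda>x. (x - a) div int m) ` V \<subseteq> {0..K}"
    proof safe
      fix x assume x: "x \<in> V"
      have "0 \<le> (x - a) div int m"
        using a(2)[OF x] m by (simp add: pos_imp_zdiv_nonneg_iff)
      moreover have "real_of_int ((x - a) div int m) \<le> 2 * B / real m"
      proof -
        have "real_of_int ((x - a) div int m) \<le> real_of_int (x - a) / real m"
          using real_of_int_div4[of "x - a" "int m"] by simp
        also have "real_of_int (x - a) \<le> 2 * B"
          using V(1)[OF x] V(1)[OF a(1)] by (simp add: abs_le_iff)
        finally show ?thesis using m by (simp add: divide_right_mono)
      qed
      ultimately show "(x - a) div int m \<in> {0..K}"
        by (simp add: K_def le_floor_iff)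
    qed
  qed simp
  moreover have "0 \<le> 2 * B / real m" using B by simp
  then have "0 \<le> K" by (simp add: K_def)
  ultimately have "real (card V) \<le> real_of_int K + 1"
    by simp
  also have "real_of_int K \<le> 2 * B / real m" by (simp add: K_def)
  finally show ?thesis by simp
qed (use B in simp)

lemma card_cong_class_ge:
  fixes a :: int
  assumes m: "0 < m"
  shows "\<lfloor>B / real m\<rfloor> \<le> int (card {x. 0 < x \<and> real_of_int x \<le> B \<and> [x = a] (mod int m)})"
proof -
  define K where "K = \<lfloor>B / real m\<rfloor>"
  \<comment> \<open>The shift by 1 puts the representative into \<open>1..m\<close>, so that
    \<open>g j\<close> is positive and at most \<open>(j + 1) * m\<close>.\<close>
  define g where "g j = (a - 1) mod int m + 1 + j * int m" for j
  have sub: "g ` {0..<K} \<subseteq> {x. 0 < x \<and> real_of_int x \<le> B \<and> [x = a] (mod int m)}"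
  proof safe
    fix j assume j: "j \<in> {0..<K}"
    have r: "0 \<le> (a - 1) mod int m" "(a - 1) mod int m < int m" using m by auto
    have "0 \<le> j * int m" using j by simp
    then show "0 < g j" using r by (simp add: g_def)
    have "g j \<le> (j + 1) * int m" using r by (simp add: g_def algebra_simps)
    also have "\<dots> \<le> K * int m" using j m by (intro mult_right_mono) auto
    finally have "real_of_int (g j) \<le> real_of_int K * real m"
      by (metis of_int_le_iff of_int_mult of_int_of_nat_eq)
    also have "\<dots> \<le> B / real m * real m"
      unfolding K_def by (intro mult_right_mono) auto
    finally show "real_of_int (g j) \<le> B" using m by simp
    have "[g j = (a - 1) + 1 + 0] (mod int m)"
      unfolding g_def by (intro cong_add) (auto simp: unique_euclidean_semiring_class.cong_def)
    then show "[g j = a] (mod int m)" by simp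
  qed
  have fin: "finite {x. 0 < x \<and> real_of_int x \<le> B \<and> [x = a] (mod int m)}"
    by (rule finite_subset[of _ "{0..\<lfloor>B\<rfloor>}"]) (auto simp: le_floor_iff)
  have "inj_on g {0..<K}" using m by (auto simp: inj_on_def g_def)
  then have "card {0..<K} \<le> card {x. 0 < x \<and> real_of_int x \<le> B \<and> [x = a] (mod int m)}"
    using card_inj_on_le[OF _ sub fin] by blast
  then show ?thesis by (simp add: K_def)
qed

lemma cong_seq_le:
  fixes a :: "nat \<Rightarrow> int"
  assumes "\<And>k. [a (Suc k) = a k] (mod int p ^ k)" "j \<le> k"
  shows "[a k = a j] (mod int p ^ j)"
  using assms(2)
proof (induction k rule: dec_induct)
  case (step k)
  have "[a (Suc k) = a k] (mod int p ^ j)"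
    using assms(1)[of k] step(1) by (meson cong_dvd_modulus le_imp_power_dvd)
  then show ?case using step(3) by (rule cong_trans)
qed simp

section \<open>Integers near prescribed p-adic limits\<close>

context prime_set
begin

definition near :: "(nat \<Rightarrow> nat \<Rightarrow> int) \<Rightarrow> (nat \<Rightarrow> nat) \<Rightarrow> int \<Rightarrow> bool" where
  "near a k x \<longleftrightarrow> (\<forall>p\<in>Q. [x = a p (k p)] (mod int p ^ k p))"

text \<open>A union bound over the choices of one limit per prime and one vector in the window; for
  each choice the integers are congruent modulo \<open>H k\<close>, which is at least
  \<open>T\<close>.\<close>

lemma card_near_le:
  assumes fin: "\<And>p. p \<in> Q \<Longrightarrow> finite (A p)"
    and coh: "\<And>p a k. p \<in> Q \<Longrightarrow> a \<in> A p \<Longrightarrow> [a (Suc k) = a k] (mod int p ^ k)"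
    and T: "1 \<le> T" "T * real M \<le> 2 ^ L" and B: "0 \<le> B"
  shows "real (card {x. \<bar>real_of_int x\<bar> \<le> B \<and>
      (\<exists>\<alpha>\<in>Pi\<^sub>E Q A. \<exists>k\<in>Q \<rightarrow>\<^sub>E UNIV. T \<le> real (H k) \<and> near \<alpha> k x)})
    \<le> real (card (Pi\<^sub>E Q A)) * (real (L + 1) ^ (card Q - 1) * real M) * (2 * B / T + 1)"
    (is "real (card ?V) \<le> _")
proof -
  define W where "W ak = {x. \<bar>real_of_int x\<bar> \<le> B \<and> near (fst ak) (snd ak) x}" for ak
  define P where "P = Pi\<^sub>E Q A \<times> exps T"
  have finE: "finite (exps T)" and cardE: "card (exps T) \<le> (L + 1) ^ (card Q - 1) * M"
    using card_exps_le[of T L] T by auto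
  have finP: "finite P"
    unfolding P_def using finE fin finite_Q by (intro finite_cartesian_product finite_PiE) auto
  have finW: "finite (W ak)" for ak
    by (rule finite_subset[of _ "{- \<lfloor>B\<rfloor>..\<lfloor>B\<rfloor>}"]) (auto simp: W_def abs_le_iff le_floor_iff, linarith)
  have sub: "?V \<subseteq> (\<Union>ak\<in>P. W ak)"
  proof safe
    fix x \<alpha> k assume x: "\<bar>real_of_int x\<bar> \<le> B" "\<alpha> \<in> Pi\<^sub>E Q A" "k \<in> Q \<rightarrow>\<^sub>E UNIV" "T \<le> real (H k)" "near \<alpha> k x"
    then obtain k' where k': "k' \<in> exps T" "\<forall>p\<in>Q. k' p \<le> k p"
      using exps_below T(1) by blast
    have "near \<alpha> k' x"
      unfolding near_def
    proof
      fix p assume p: "p \<in> Q"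
      have "\<alpha> p \<in> A p" using x(2) p by (rule PiE_mem)
      have "[\<alpha> p (k p) = \<alpha> p (k' p)] (mod int p ^ k' p)"
        by (rule cong_seq_le[OF coh[OF p \<open>\<alpha> p \<in> A p\<close>]]) (use k'(2) p in blast)
      moreover have "[x = \<alpha> p (k p)] (mod int p ^ k' p)"
        using x(5) p k'(2) unfolding near_def by (meson cong_dvd_modulus le_imp_power_dvd)
      ultimately show "[x = \<alpha> p (k' p)] (mod int p ^ k' p)"
        by (metis cong_trans)
    qed
    then show "x \<in> (\<Union>ak\<in>P. W ak)"
      using x k' by (intro UN_I[of "(\<alpha>, k')"]) (auto simp: P_def W_def)
  qed
  have W: "real (card (W ak)) \<le> 2 * B / T + 1" if "ak \<in> P" for ak
  proof -
    have "real (card (W ak)) \<le> 2 * B / real (H (snd ak)) + 1"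
    proof (rule card_cong_class_le)
      fix x y assume xy: "x \<in> W ak" "y \<in> W ak"
      have "[x = y] (mod int p ^ snd ak p)" if "p \<in> Q" for p
      proof -
        have "[x = fst ak p (snd ak p)] (mod int p ^ snd ak p)" "[y = fst ak p (snd ak p)] (mod int p ^ snd ak p)"
          using xy that unfolding W_def near_def by auto
        then show ?thesis by (metis cong_sym cong_trans)
      qed
      then show "int (H (snd ak)) dvd x - y"
        by (simp add: H_dvd_iff cong_iff_dvd_diff)
    qed (use B H_pos in \<open>auto simp: W_def\<close>)
    also have "\<dots> \<le> 2 * B / T + 1"
      using that T(1) B by (auto simp: P_def exps_def intro!: divide_left_mono mult_pos_pos)
    finally show ?thesis .
  qed
  have "card ?V \<le> card (\<Union>ak\<in>P. W ak)"
    using finP finW by (intro card_mono[OF _ sub]) auto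
  also have "\<dots> \<le> (\<Sum>ak\<in>P. card (W ak))"
    by (rule card_UN_le[OF finP])
  finally have "real (card ?V) \<le> (\<Sum>ak\<in>P. real (card (W ak)))"
    by (simp flip: of_nat_sum)
  also have "\<dots> \<le> real (card P) * (2 * B / T + 1)"
    using sum_bounded_above[of P "\<lambda>ak. real (card (W ak))"] W by simp
  also have "\<dots> \<le> real (card (Pi\<^sub>E Q A) * ((L + 1) ^ (card Q - 1) * M)) * (2 * B / T + 1)"
  proof (rule mult_right_mono)
    have "card P \<le> card (Pi\<^sub>E Q A) * ((L + 1) ^ (card Q - 1) * M)"
      unfolding P_def card_cartesian_product using cardE by (rule mult_le_mono2)
    then show "real (card P) \<le> real (card (Pi\<^sub>E Q A) * ((L + 1) ^ (card Q - 1) * M))"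
      by (rule of_nat_mono)
    show "0 \<le> 2 * B / T + 1" using B T(1) by simp
  qed
  finally show ?thesis by simp
qed

text \<open>
  The integers counted for an exponent vector \<open>k\<close> agree with \<open>a p\<close> to the exact order \<open>k p\<close>,
  so different vectors yield disjoint sets.
\<close>

lemma card_near_ge:
  assumes coh: "\<And>p k. p \<in> Q \<Longrightarrow> [a p (Suc k) = a p k] (mod int p ^ k)"
    and T: "1 \<le> T" and fin: "finite (exps T)" and B: "0 \<le> B"
  shows "real (card (exps T)) * of_int \<lfloor>B / (T * real M * real (\<Prod>Q))\<rfloor>
    \<le> real (card {x. 0 < x \<and> real_of_int x \<le> B \<and> (\<exists>k\<in>Q \<rightarrow>\<^sub>E UNIV. T \<le> real (H k) \<and> near a k x)})"
    (is "_ \<le> real (card ?V)")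
proof -
  \<comment> \<open>Adding \<open>p ^ k p\<close> to the limit makes the agreement fail at the very
    next level; the Chinese remainder theorem imposes this at all primes at once.\<close>
  have "\<exists>y. \<forall>p\<in>Q. [y = a p (Suc (k p)) + int p ^ k p] (mod int p ^ Suc (k p))" for k
  proof -
    define u where "u p = nat ((a p (Suc (k p)) + int p ^ k p) mod int p ^ Suc (k p))" for p
    have "\<forall>p\<in>Q. \<forall>q\<in>Q. p \<noteq> q \<longrightarrow> Rings.coprime (p ^ Suc (k p)) (q ^ Suc (k q))"
      using prime_Q by (auto intro!: primes_coprime simp del: power_Suc)
    then obtain y where y: "\<forall>p\<in>Q. [y = u p] (mod p ^ Suc (k p))"
      using chinese_remainder_nat[OF finite_Q, of "\<lambda>p. p ^ Suc (k p)" u] by blast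
    have "[int y = a p (Suc (k p)) + int p ^ k p] (mod int p ^ Suc (k p))" if "p \<in> Q" for p
    proof -
      have "[int y = int (u p)] (mod int (p ^ Suc (k p)))"
        using y that by (subst cong_int_iff) auto
      moreover have "int (u p) = (a p (Suc (k p)) + int p ^ k p) mod int p ^ Suc (k p)"
        unfolding u_def using Q_ge_2[OF that] by (simp del: power_Suc)
      ultimately show ?thesis by (simp add: unique_euclidean_semiring_class.cong_def del: power_Suc)
    qed
    then show ?thesis by blast
  qed
  then obtain y where y: "\<And>k p. p \<in> Q \<Longrightarrow> [y k = a p (Suc (k p)) + int p ^ k p] (mod int p ^ Suc (k p))"
    by metis
  define C where "C k = {x. 0 < x \<and> real_of_int x \<le> B \<and> [x = y k] (mod int (H (\<lambda>p. Suc (k p))))}" for k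
  have C: "[x = a p (Suc (k p)) + int p ^ k p] (mod int p ^ Suc (k p))" if "x \<in> C k" "p \<in> Q" for x k p
  proof -
    have "int p ^ Suc (k p) dvd int (H (\<lambda>p. Suc (k p)))"
      using power_dvd_H[OF that(2), of "\<lambda>p. Suc (k p)"] by (metis int_dvd_int_iff of_nat_power)
    then have "[x = y k] (mod int p ^ Suc (k p))"
      using that(1) unfolding C_def by (auto intro: cong_dvd_modulus)
    then show ?thesis using y[OF that(2)] by (rule cong_trans)
  qed
  have C1: "[x = a p (k p)] (mod int p ^ k p)" if "x \<in> C k" "p \<in> Q" for x k p
  proof -
    have "[x = a p (Suc (k p)) + int p ^ k p] (mod int p ^ k p)"
      using C[OF that] by (rule cong_dvd_modulus) simp
    moreover have "[a p (Suc (k p)) + int p ^ k p = a p (k p) + 0] (mod int p ^ k p)"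
      by (rule cong_add[OF coh[OF that(2)]]) (simp add: cong_0_iff)
    ultimately show ?thesis by (metis add_0_right cong_trans)
  qed
  have C2: "\<not> [x = a p (Suc (k p))] (mod int p ^ Suc (k p))" if "x \<in> C k" "p \<in> Q" for x k p
  proof
    assume "[x = a p (Suc (k p))] (mod int p ^ Suc (k p))"
    then have "[a p (Suc (k p)) + int p ^ k p = a p (Suc (k p)) + 0] (mod int p ^ Suc (k p))"
      using C[OF that] by (metis add_0_right cong_sym cong_trans)
    then have "int p ^ Suc (k p) dvd int p ^ k p"
      by (simp only: cong_add_lcancel cong_0_iff)
    then show False using Q_ge_2[OF that(2)]
      by (metis Suc_n_not_le_n int_dvd_int_iff of_nat_power power_dvd_imp_le less_le_trans one_less_numeral_iff semiring_norm(76))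
  qed
  have disj: "k p = k' p" if "x \<in> C k" "x \<in> C k'" "p \<in> Q" for x k k' p
  proof -
    have *: False if "x \<in> C k" "x \<in> C k'" "k p < k' p" for k k'
    proof -
      have "[a p (k' p) = a p (Suc (k p))] (mod int p ^ Suc (k p))"
        by (rule cong_seq_le[OF coh[OF \<open>p \<in> Q\<close>]]) (use that(3) in simp)
      moreover have "[x = a p (k' p)] (mod int p ^ Suc (k p))"
        using C1[OF that(2) \<open>p \<in> Q\<close>] that(3) by (meson Suc_leI cong_dvd_modulus le_imp_power_dvd)
      ultimately show False
        using C2[OF that(1) \<open>p \<in> Q\<close>] by (metis cong_trans)
    qed
    show ?thesis using *[of k k'] *[of k' k] that by (metis nat_neq_iff)
  qed
  have finC: "finite (C k)" for k
    by (rule finite_subset[of _ "{0..\<lfloor>B\<rfloor>}"]) (auto simp: C_def le_floor_iff)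
  \<comment> \<open>Fixing the exact order costs one more power of each prime, whence the factor
    \<open>\<Prod>Q\<close> in the modulus.\<close>
  have card_C: "of_int \<lfloor>B / (T * real M * real (\<Prod>Q))\<rfloor> \<le> real (card (C k))" if "k \<in> exps T" for k
  proof -
    have HS: "H (\<lambda>p. Suc (k p)) = H k * \<Prod>Q"
      by (simp add: H_def prod.distrib mult.commute)
    have "real (H (\<lambda>p. Suc (k p))) \<le> T * real M * real (\<Prod>Q)"
      unfolding HS using that by (auto simp: exps_def intro!: mult_right_mono prod_nonneg)
    then have "B / (T * real M * real (\<Prod>Q)) \<le> B / real (H (\<lambda>p. Suc (k p)))"
      using H_pos[of "\<lambda>p. Suc (k p)"] B by (intro frac_le) auto
    then have "\<lfloor>B / (T * real M * real (\<Prod>Q))\<rfloor> \<le> \<lfloor>B / real (H (\<lambda>p. Suc (k p)))\<rfloor>"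
      by (rule floor_mono)
    also have "\<dots> \<le> int (card (C k))"
      unfolding C_def by (rule card_cong_class_ge[OF H_pos])
    finally show ?thesis by linarith
  qed
  have "real (card (exps T)) * of_int \<lfloor>B / (T * real M * real (\<Prod>Q))\<rfloor> \<le> (\<Sum>k\<in>exps T. real (card (C k)))"
    using sum_bounded_below[of "exps T" "of_int \<lfloor>B / (T * real M * real (\<Prod>Q))\<rfloor>" "\<lambda>k. real (card (C k))"] card_C by simp
  also have "\<dots> = real (card (\<Union>k\<in>exps T. C k))"
  proof (subst card_UN_disjoint)
    show "\<forall>k\<in>exps T. \<forall>k'\<in>exps T. k \<noteq> k' \<longrightarrow> C k \<inter> C k' = {}"
    proof (intro ballI impI)
      fix k k' assume k: "k \<in> exps T" "k' \<in> exps T" "k \<noteq> k'"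
      then obtain p where "p \<in> Q" "k p \<noteq> k' p"
        unfolding exps_def by (metis (no_types, lifting) PiE_ext mem_Collect_eq)
      then show "C k \<inter> C k' = {}" using disj by blast
    qed
  qed (use fin finC in auto)
  also have "\<dots> \<le> real (card ?V)"
  proof (rule of_nat_mono, rule card_mono)
    show "finite ?V"
      by (rule finite_subset[of _ "{0..\<lfloor>B\<rfloor>}"]) (auto simp: le_floor_iff)
    show "(\<Union>k\<in>exps T. C k) \<subseteq> ?V"
    proof
      fix x assume "x \<in> (\<Union>k\<in>exps T. C k)"
      then obtain k where k: "k \<in> exps T" "x \<in> C k" by blast
      then have "near a k x" using C1 by (auto simp: near_def)
      then show "x \<in> ?V" using k by (auto simp: exps_def C_def)
    qed
  qed
  finally show ?thesis .
qed

end

text \<open>Halving \<open>B\<close> shrinks the bound by at least the factor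
  \<open>r = 2 powr (- \<delta>) < 1\<close>, so the errors of the successive steps form a
  convergent geometric series. Instead of summing it, the induction over dyadic ranges carries a
  constant \<open>D\<close> with \<open>D * r + C \<le> D\<close>.\<close>

lemma eventually_le_if_dyadic_step:
  fixes G :: "real \<Rightarrow> real" and \<delta> :: real
  assumes \<delta>: "0 < \<delta>" and C: "0 \<le> C" and mono: "\<And>x y. x \<le> y \<Longrightarrow> G x \<le> G y"
    and step: "\<forall>\<^sub>F B in at_top. G B \<le> G (B / 2) + C * (B powr \<delta> * ln B ^ m)"
  shows "\<exists>D>0. \<forall>\<^sub>F B in at_top. G B \<le> D * (B powr \<delta> * ln B ^ m)"
proof -
  obtain B1 where B1: "\<And>B. B \<ge> B1 \<Longrightarrow> G B \<le> G (B / 2) + C * (B powr \<delta> * ln B ^ m)"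
    using step unfolding eventually_at_top_linorder by blast
  define b where "b = max 2 B1"
  define g where "g B = B powr \<delta> * ln B ^ m" for B :: real
  have g_mono: "g x \<le> g y" if "1 \<le> x" "x \<le> y" for x y
    unfolding g_def using that \<delta> by (intro mult_mono power_mono powr_mono2) auto
  have g_pos: "0 < g x" if "1 < x" for x
    unfolding g_def using that by (intro mult_pos_pos zero_less_power) auto
  define r where "r = (1/2::real) powr \<delta>"
  have r: "0 < r" "r < 1"
    using \<delta> by (simp_all add: r_def powr_def ln_div)
  have half: "g (B / 2) \<le> r * g B" if "2 \<le> B" for B
  proof -
    have "(B / 2) powr \<delta> = r * B powr \<delta>"
      using that by (simp add: r_def powr_divide)
    moreover have "ln (B / 2) ^ m \<le> ln B ^ m"
      using that by (intro power_mono) auto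
    ultimately show ?thesis
      using r unfolding g_def by (simp add: mult.assoc mult_left_mono)
  qed
  \<comment> \<open>The three entries give positivity, the base range from \<open>b\<close> to
    \<open>2 * b\<close> by monotonicity, and the inequality of the induction step.\<close>
  define D where "D = max (max 1 (G (2 * b) / g b)) (C / (1 - r))"
  have D: "1 \<le> D" "G (2 * b) / g b \<le> D" "C / (1 - r) \<le> D"
    by (auto simp: D_def)
  have b: "2 \<le> b" "B1 \<le> b" by (auto simp: b_def)
  have "\<forall>B. b \<le> B \<and> B \<le> 2 ^ Suc i * b \<longrightarrow> G B \<le> D * g B" for i
  proof (induction i)
    case 0
    show ?case
    proof safe
      fix B assume B: "b \<le> B" "B \<le> 2 ^ Suc 0 * b"
      have "G B \<le> G (2 * b)" using B by (intro mono) simp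
      also have "\<dots> \<le> D * g b" using D(2) g_pos[of b] b by (simp add: pos_divide_le_eq)
      also have "\<dots> \<le> D * g B" using D(1) B b by (intro mult_left_mono g_mono) auto
      finally show "G B \<le> D * g B" .
    qed
  next
    case (Suc i)
    show ?case
    proof safe
      fix B assume B: "b \<le> B" "B \<le> 2 ^ Suc (Suc i) * b"
      show "G B \<le> D * g B"
      proof (cases "B \<le> 2 ^ Suc i * b")
        case False
        have "2 * b \<le> 2 ^ Suc i * b" using b by simp
        then have B2: "b \<le> B / 2" "B / 2 \<le> 2 ^ Suc i * b" using False B by auto
        have "G B \<le> G (B / 2) + C * g B" using B1[of B] B b by (simp add: g_def)
        also have "G (B / 2) \<le> D * g (B / 2)" using Suc B2 by blast
        also have "\<dots> \<le> D * (r * g B)" using D(1) B b by (intro mult_left_mono half) auto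
        also have "C \<le> D * (1 - r)" using D(3) r by (simp add: pos_divide_le_eq)
        then have "C * g B \<le> D * (1 - r) * g B" using g_pos[of B] B b by (intro mult_right_mono) auto
        then have "D * (r * g B) + C * g B \<le> D * g B" by (simp add: algebra_simps)
        finally show ?thesis by simp
      qed (use Suc B in blast)
    qed
  qed
  note bound = this
  have "G B \<le> D * g B" if "b \<le> B" for B
  proof -
    obtain i where "B / b < 2 ^ i" using real_arch_pow[of 2 "B / b"] by auto
    then have "B < 2 ^ i * b" using b by (simp add: pos_divide_less_eq)
    also have "\<dots> \<le> 2 ^ Suc i * b" using b by simp
    finally show ?thesis using bound[of i] that by auto
  qed
  then show ?thesis
    using D(1) unfolding g_def eventually_at_top_linorder by (intro exI[of _ D]) auto
qed

section \<open>The two counting bounds\<close>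

context prime_set
begin

text \<open>For \<open>B / 2 < \<bar>x\<bar> \<le> B\<close> the varying threshold is at least
  \<open>t * (B / 2) powr \<theta>\<close>, so that range is handled by \<open>card_near_le\<close>;
  smaller \<open>x\<close> are left to the dyadic induction.\<close>

lemma count_upper:
  fixes \<theta> t x0 :: real
  assumes fin: "\<And>p. p \<in> Q \<Longrightarrow> finite (A p)"
    and coh: "\<And>p a k. p \<in> Q \<Longrightarrow> a \<in> A p \<Longrightarrow> [a (Suc k) = a k] (mod int p ^ k)"
    and \<theta>: "0 < \<theta>" "\<theta> < 1" and t: "0 < t"
    and good: "\<And>x. good x \<Longrightarrow> x0 \<le> \<bar>real_of_int x\<bar> \<Longrightarrow>
      \<exists>\<alpha>\<in>Pi\<^sub>E Q A. \<exists>k\<in>Q \<rightarrow>\<^sub>E UNIV. t * \<bar>real_of_int x\<bar> powr \<theta> \<le> real (H k) \<and> near \<alpha> k x"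
  shows "\<exists>D>0. \<forall>\<^sub>F B in at_top. real (card {x. \<bar>real_of_int x\<bar> \<le> B \<and> good x})
    \<le> D * (B powr (1 - \<theta>) * ln B ^ (card Q - 1))"
proof -
  define m where "m = card Q - 1"
  define N where "N = real (card (Pi\<^sub>E Q A))"
  define V where "V B = {x. \<bar>real_of_int x\<bar> \<le> B \<and> good x}" for B
  \<comment> \<open>Chosen so that \<open>L + 1 \<le> D * ln B\<close>, where \<open>2 ^ L\<close>
    bounds the window; the 2 covers the rounding and the \<open>+ 1\<close>.\<close>
  define D where "D = \<bar>ln (t * real M) / ln 2\<bar> + \<theta> / ln 2 + 2"
  define C where "C = N * (D ^ m * real M) * (2 * 2 powr \<theta> / t + 1)"
  have D: "0 \<le> D" using \<theta> by (simp add: D_def)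
  have finV: "finite {x. \<bar>real_of_int x\<bar> \<le> B \<and> R x}" for B R
    by (rule finite_subset[of _ "{- \<lfloor>B\<rfloor>..\<lfloor>B\<rfloor>}"]) (auto simp: abs_le_iff le_floor_iff, linarith)
  have "\<forall>\<^sub>F B in at_top. 1 \<le> t * (B / 2) powr \<theta>"
    using t \<theta> by real_asymp
  moreover have "\<forall>\<^sub>F B in at_top. 1 \<le> ln (B :: real)"
    by real_asymp
  ultimately have "\<forall>\<^sub>F B in at_top. real (card (V B)) \<le> real (card (V (B / 2))) + C * (B powr (1 - \<theta>) * ln B ^ m)"
    using eventually_ge_at_top[of 2] eventually_ge_at_top[of "2 * x0"]
  proof eventually_elim
    case (elim B)
    define T where "T = t * (B / 2) powr \<theta>"
    define L where "L = nat \<lceil>log 2 (T * real M)\<rceil>"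
    define W where "W = {x. \<bar>real_of_int x\<bar> \<le> B \<and>
      (\<exists>\<alpha>\<in>Pi\<^sub>E Q A. \<exists>k\<in>Q \<rightarrow>\<^sub>E UNIV. T \<le> real (H k) \<and> near \<alpha> k x)}"
    have T: "1 \<le> T" using elim by (simp add: T_def)
    have TM: "1 \<le> T * real M" using mult_mono[OF T, of 1 "real M"] T M_ge_2 by simp
    then have log0: "0 \<le> log 2 (T * real M)" by simp
    have "T * real M = 2 powr (log 2 (T * real M))" using TM by simp
    also have "\<dots> \<le> 2 powr real L"
      unfolding L_def by (intro powr_mono) (auto intro: order_trans[OF real_nat_ceiling_ge])
    finally have L: "T * real M \<le> 2 ^ L" by (simp add: powr_realpow)
    have "real L \<le> log 2 (T * real M) + 1"
      unfolding L_def using log0 by linarith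
    also have "log 2 (T * real M) = ln (t * real M * (B / 2) powr \<theta>) / ln 2"
      by (simp add: log_def T_def mult_ac)
    also have "ln (t * real M * (B / 2) powr \<theta>) = ln (t * real M) + \<theta> * ln (B / 2)"
      using t M_ge_2 elim(3) by (simp add: ln_mult ln_powr)
    finally have L1: "real (L + 1) \<le> ln (t * real M) / ln 2 + \<theta> / ln 2 * ln (B / 2) + 2"
      by (simp add: add_divide_distrib)
    have "ln (t * real M) / ln 2 \<le> \<bar>ln (t * real M) / ln 2\<bar> * 1"
      unfolding mult_1_right by (rule abs_ge_self)
    also have "\<dots> \<le> \<bar>ln (t * real M) / ln 2\<bar> * ln B" using elim(2) by (intro mult_left_mono) auto
    finally have "ln (t * real M) / ln 2 \<le> \<bar>ln (t * real M) / ln 2\<bar> * ln B" .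
    moreover have "\<theta> / ln 2 * ln (B / 2) \<le> \<theta> / ln 2 * ln B"
      using \<theta> elim(3) by (intro mult_left_mono) auto
    ultimately have L2: "real (L + 1) \<le> D * ln B"
      using L1 elim(2) unfolding D_def by (simp only: distrib_right)
    have "V B \<subseteq> V (B / 2) \<union> W"
    proof
      fix x assume x: "x \<in> V B"
      show "x \<in> V (B / 2) \<union> W"
      proof (cases "\<bar>real_of_int x\<bar> \<le> B / 2")
        case True
        then show ?thesis using x by (simp add: V_def)
      next
        case False
        then have "x0 \<le> \<bar>real_of_int x\<bar>" using elim(4) by linarith
        moreover have "good x" using x by (simp add: V_def)
        ultimately obtain \<alpha> k where *: "\<alpha> \<in> Pi\<^sub>E Q A" "k \<in> Q \<rightarrow>\<^sub>E UNIV"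
            "t * \<bar>real_of_int x\<bar> powr \<theta> \<le> real (H k)" "near \<alpha> k x"
          using good by blast
        have "T \<le> t * \<bar>real_of_int x\<bar> powr \<theta>"
          unfolding T_def using False t \<theta> elim(3) by (intro mult_left_mono powr_mono2) auto
        then have "T \<le> real (H k)" using *(3) by linarith
        then have "x \<in> W" unfolding W_def using * x by (auto simp: V_def)
        then show ?thesis by simp
      qed
    qed
    then have "card (V B) \<le> card (V (B / 2) \<union> W)"
      unfolding V_def W_def by (intro card_mono finite_UnI finV)
    then have "real (card (V B)) \<le> real (card (V (B / 2))) + real (card W)"
      using card_Un_le[of "V (B / 2)" W] by linarith
    also have "real (card W) \<le> N * (real (L + 1) ^ m * real M) * (2 * B / T + 1)"
      unfolding W_def N_def m_def using elim(3) fin coh T L by (intro card_near_le) auto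
    also have "\<dots> \<le> N * ((D * ln B) ^ m * real M) * ((2 * 2 powr \<theta> / t + 1) * B powr (1 - \<theta>))"
    proof (intro mult_mono mult_left_mono mult_right_mono power_mono L2)
      have "2 * B / T = 2 * 2 powr \<theta> / t * B powr (1 - \<theta>)"
        using elim(3) t by (simp add: T_def powr_divide powr_diff)
      \<comment> \<open>The \<open>+ 1\<close> per residue class is absorbed into the main term
        because \<open>\<theta> < 1\<close>.\<close>
      moreover have "1 \<le> B powr (1 - \<theta>)"
        using elim(3) \<theta> by (intro ge_one_powr_ge_zero) auto
      ultimately show "2 * B / T + 1 \<le> (2 * 2 powr \<theta> / t + 1) * B powr (1 - \<theta>)"
        by (simp add: algebra_simps)
    qed (use elim T D in \<open>auto simp: N_def\<close>)
    also have "\<dots> = C * (B powr (1 - \<theta>) * ln B ^ m)"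
      by (simp add: C_def power_mult_distrib mult_ac)
    finally show ?case by simp
  qed
  moreover have "0 \<le> C" using D t by (simp add: C_def N_def)
  moreover have "real (card (V x)) \<le> real (card (V y))" if "x \<le> y" for x y
    unfolding V_def using that by (intro of_nat_mono card_mono finV) auto
  ultimately show ?thesis
    unfolding m_def[symmetric] V_def[symmetric] using \<theta> by (intro eventually_le_if_dyadic_step) auto
qed

text \<open>A threshold taken at \<open>B\<close> serves all positive \<open>x\<close> up to
  \<open>B\<close>. The set \<open>E\<close> collects integers that are close enough yet not
  counted; being finite, it costs only a constant factor.\<close>

lemma count_lower:
  fixes \<theta> t b :: real
  assumes coh: "\<And>p k. p \<in> Q \<Longrightarrow> [a p (Suc k) = a p k] (mod int p ^ k)"
    and \<theta>: "0 < \<theta>" "\<theta> < 1" and t: "0 < t" and E: "finite E"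
    and good: "\<And>B x k. b \<le> B \<Longrightarrow> 0 < x \<Longrightarrow> real_of_int x \<le> B \<Longrightarrow> k \<in> Q \<rightarrow>\<^sub>E UNIV \<Longrightarrow>
      t * B powr \<theta> \<le> real (H k) \<Longrightarrow> near a k x \<Longrightarrow> good x \<or> x \<in> E"
  shows "\<exists>c>0. \<forall>\<^sub>F B in at_top. c * (B powr (1 - \<theta>) * ln B ^ (card Q - 1))
    \<le> real (card {x. \<bar>real_of_int x\<bar> \<le> B \<and> good x})"
proof -
  define s where "s = card Q"
  have s: "0 < s" using finite_Q Q_nonempty by (simp add: s_def card_gt_0_iff)
  \<comment> \<open>Half of \<open>\<theta>\<close> is given up to absorb \<open>ln t\<close>, so
    that \<open>\<theta> / 2 * ln B \<le> ln T\<close>.\<close>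
  define c0 where "c0 = \<theta> / 2 / (real s * ln (real M))"
  define K where "K = t * real M * real (\<Prod>Q)"
  have lnM: "0 < ln (real M)" using M_ge_2 by simp
  have c0: "0 < c0" using \<theta> s lnM by (simp add: c0_def)
  have "0 < \<Prod>Q" using Q_ge_2 by (intro prod_pos) fastforce
  then have K: "0 < K" using t M_ge_2 by (simp add: K_def del: of_nat_prod)
  \<comment> \<open>In the 4, one factor 2 pays for the floor and the other for the exceptional set
    \<open>E\<close>.\<close>
  define c where "c = c0 ^ (s - 1) / (4 * K)"
  have c: "0 < c" using c0 K by (simp add: c_def)
  define g where "g B = B powr (1 - \<theta>) * ln B ^ (s - 1)" for B :: real
  have "\<forall>\<^sub>F B in at_top. 1 \<le> t * B powr \<theta>"
    using t \<theta> by real_asymp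
  moreover have "\<forall>\<^sub>F B in at_top. 1 \<le> ln (B :: real)"
    by real_asymp
  moreover have "\<forall>\<^sub>F B in at_top. 1 \<le> B powr (1 - \<theta>) / K"
    using K \<theta> by real_asymp
  moreover have "\<forall>\<^sub>F B in at_top. - ln t \<le> \<theta> / 2 * ln B"
    using \<theta> by real_asymp
  moreover have "\<forall>\<^sub>F B in at_top. real (card E) / c \<le> B powr (1 - \<theta>)"
    using \<theta> by real_asymp
  ultimately have "\<forall>\<^sub>F B in at_top. c * g B \<le> real (card {x. \<bar>real_of_int x\<bar> \<le> B \<and> good x})"
    using eventually_ge_at_top[of 2] eventually_ge_at_top[of b]
  proof eventually_elim
    case (elim B)
    define T where "T = t * B powr \<theta>"
    \<comment> \<open>Dividing by \<open>s\<close> rather than \<open>s - 1\<close> still gives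
      \<open>M ^ (L * (s - 1)) \<le> T\<close> and avoids a zero denominator when
      \<open>s = 1\<close>.\<close>
    define L where "L = nat \<lfloor>ln T / (real s * ln (real M))\<rfloor>"
    have T: "1 \<le> T" using elim by (simp add: T_def)
    have q0: "0 \<le> ln T / (real s * ln (real M))" using T lnM by simp
    then have L1: "real L \<le> ln T / (real s * ln (real M))"
      and L2: "ln T / (real s * ln (real M)) \<le> real (L + 1)"
      unfolding L_def by linarith+
    have "real (L * (s - 1)) * ln (real M) \<le> real (L * s) * ln (real M)"
      using lnM by (intro mult_right_mono of_nat_mono) auto
    also have "\<dots> = real L * (real s * ln (real M))" by simp
    also have "\<dots> \<le> ln T"
      using L1 s lnM by (simp add: pos_le_divide_eq)
    finally have "real (L * (s - 1)) * ln (real M) \<le> ln T" .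
    then have "exp (real (L * (s - 1)) * ln (real M)) \<le> T"
      using T by (simp add: ln_ge_iff)
    moreover have "exp (real (L * (s - 1)) * ln (real M)) = real M ^ (L * (s - 1))"
      using M_ge_2 by (subst exp_of_nat_mult) simp
    ultimately have powM: "real M ^ (L * (s - 1)) \<le> T" by simp
    have finE: "finite (exps T)"
    proof -
      obtain i where "T * real M < 2 ^ i" using real_arch_pow[of 2 "T * real M"] by auto
      then show ?thesis using card_exps_le(1)[of T i] T by auto
    qed
    have "(L + 1) ^ (s - 1) \<le> card (exps T)"
      unfolding s_def using T powM finE by (intro card_exps_ge) (auto simp: s_def)
    then have cardE: "real (L + 1) ^ (s - 1) \<le> real (card (exps T))"
      by (metis of_nat_le_iff of_nat_power)
    have "\<theta> / 2 * ln B \<le> ln T"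
      using elim(4) t elim(6) by (simp add: T_def ln_mult ln_powr)
    then have "\<theta> / 2 * ln B / (real s * ln (real M)) \<le> ln T / (real s * ln (real M))"
      using lnM by (intro divide_right_mono) auto
    then have "c0 * ln B \<le> ln T / (real s * ln (real M))"
      by (simp add: c0_def)
    then have "(c0 * ln B) ^ (s - 1) \<le> real (L + 1) ^ (s - 1)"
      using L2 c0 elim(2) by (intro power_mono) auto
    then have cardE2: "(c0 * ln B) ^ (s - 1) \<le> real (card (exps T))"
      using cardE by linarith
    have BT: "B / (T * real M * real (\<Prod>Q)) = B powr (1 - \<theta>) / K"
      using elim(6) by (simp add: T_def K_def powr_diff mult_ac)
    have fl: "B powr (1 - \<theta>) / (2 * K) \<le> of_int \<lfloor>B / (T * real M * real (\<Prod>Q))\<rfloor>"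
    proof -
      have "y / 2 \<le> of_int \<lfloor>y\<rfloor>" if "1 \<le> y" for y :: real
      proof -
        have "1 \<le> \<lfloor>y\<rfloor>" using that by simp
        then show ?thesis by linarith
      qed
      from this[OF elim(3)] show ?thesis unfolding BT by simp
    qed
    define W where "W = {x. 0 < x \<and> real_of_int x \<le> B \<and> (\<exists>k\<in>Q \<rightarrow>\<^sub>E UNIV. T \<le> real (H k) \<and> near a k x)}"
    have "2 * c * g B = (c0 * ln B) ^ (s - 1) * (B powr (1 - \<theta>) / (2 * K))"
      by (simp add: c_def g_def power_mult_distrib)
    also have "\<dots> \<le> real (card (exps T)) * of_int \<lfloor>B / (T * real M * real (\<Prod>Q))\<rfloor>"
      using cardE2 fl K by (intro mult_mono) auto
    also have "\<dots> \<le> real (card W)"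
      unfolding W_def using coh T finE elim(6) by (intro card_near_ge) auto
    finally have W: "2 * c * g B \<le> real (card W)" .
    have finG: "finite {x. \<bar>real_of_int x\<bar> \<le> B \<and> good x}"
      by (rule finite_subset[of _ "{- \<lfloor>B\<rfloor>..\<lfloor>B\<rfloor>}"]) (auto simp: abs_le_iff le_floor_iff, linarith)
    have "W \<subseteq> {x. \<bar>real_of_int x\<bar> \<le> B \<and> good x} \<union> E"
      unfolding W_def T_def using good elim(7) by fastforce
    then have "card W \<le> card ({x. \<bar>real_of_int x\<bar> \<le> B \<and> good x} \<union> E)"
      using finG E by (intro card_mono) auto
    also have "\<dots> \<le> card {x. \<bar>real_of_int x\<bar> \<le> B \<and> good x} + card E"
      by (rule card_Un_le)
    finally have "real (card W) \<le> real (card {x. \<bar>real_of_int x\<bar> \<le> B \<and> good x}) + real (card E)"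
      by linarith
    moreover have "real (card E) \<le> c * g B"
    proof -
      have "real (card E) \<le> c * B powr (1 - \<theta>)"
        using elim(5) c by (simp add: pos_divide_le_eq mult.commute)
      also have "\<dots> \<le> c * g B"
        unfolding g_def using c elim(2) by (intro mult_left_mono) (auto intro: mult_right_mono[of 1, simplified] one_le_power simp: mult_le_cancel_left1)
      finally show ?thesis .
    qed
    ultimately show ?case using W by simp
  qed
  then show ?thesis using c unfolding g_def s_def by blast
qed

end

section \<open>The main theorem\<close>

lemma abs_poly_le:
  fixes f :: "int poly"
  assumes "x \<noteq> 0"
  shows "\<bar>poly f x\<bar> \<le> (\<Sum>i\<le>Polynomial.degree f. \<bar>Polynomial.coeff f i\<bar>) * \<bar>x\<bar> ^ Polynomial.degree f"
proof -
  have "\<bar>poly f x\<bar> \<le> (\<Sum>i\<le>Polynomial.degree f. \<bar>Polynomial.coeff f i * x ^ i\<bar>)"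
    unfolding poly_altdef by (rule sum_abs)
  also have "\<dots> \<le> (\<Sum>i\<le>Polynomial.degree f. \<bar>Polynomial.coeff f i\<bar> * \<bar>x\<bar> ^ Polynomial.degree f)"
    using assms by (intro sum_mono) (auto simp: abs_mult power_abs intro!: mult_left_mono power_increasing)
  finally show ?thesis by (simp add: sum_distrib_right)
qed

lemma abs_poly_ge:
  fixes f :: "int poly"
  assumes f: "f \<noteq> 0" and x: "x \<noteq> 0" "2 * (\<Sum>i<Polynomial.degree f. \<bar>Polynomial.coeff f i\<bar>) \<le> \<bar>x\<bar>"
  shows "\<bar>x\<bar> ^ Polynomial.degree f \<le> 2 * \<bar>poly f x\<bar>"
proof -
  define n where "n = Polynomial.degree f"
  define s where "s = (\<Sum>i<n. \<bar>Polynomial.coeff f i\<bar>)"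
  have "\<bar>\<Sum>i<n. Polynomial.coeff f i * x ^ i\<bar> \<le> (\<Sum>i<n. \<bar>Polynomial.coeff f i * x ^ i\<bar>)"
    by (rule sum_abs)
  also have "\<dots> \<le> (\<Sum>i<n. \<bar>Polynomial.coeff f i\<bar> * \<bar>x\<bar> ^ (n - 1))"
    using x(1) by (intro sum_mono) (auto simp: abs_mult power_abs intro!: mult_left_mono power_increasing)
  also have "\<dots> = s * \<bar>x\<bar> ^ (n - 1)"
    by (simp add: s_def sum_distrib_right)
  finally have lower_terms: "\<bar>\<Sum>i<n. Polynomial.coeff f i * x ^ i\<bar> \<le> s * \<bar>x\<bar> ^ (n - 1)" .
  have "2 * (s * \<bar>x\<bar> ^ (n - 1)) \<le> \<bar>x\<bar> ^ n"
  proof (cases n)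
    case (Suc m)
    have "2 * s * \<bar>x\<bar> ^ m \<le> \<bar>x\<bar> * \<bar>x\<bar> ^ m"
      using x(2) by (intro mult_right_mono) (auto simp: s_def n_def)
    then show ?thesis by (simp add: Suc)
  qed (simp add: s_def)
  moreover have "1 * \<bar>x\<bar> ^ n \<le> \<bar>Polynomial.lead_coeff f\<bar> * \<bar>x\<bar> ^ n"
    using f by (intro mult_right_mono) (auto simp: int_one_le_iff_zero_less)
  moreover have "poly f x = (\<Sum>i<n. Polynomial.coeff f i * x ^ i) + Polynomial.lead_coeff f * x ^ n"
    by (simp add: poly_altdef n_def flip: lessThan_Suc_atMost)
  moreover have "\<bar>Polynomial.lead_coeff f * x ^ n\<bar> = \<bar>Polynomial.lead_coeff f\<bar> * \<bar>x\<bar> ^ n"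
    by (simp add: abs_mult power_abs)
  ultimately show ?thesis
    using lower_terms unfolding n_def by linarith
qed

theorem mainTheorem3:
  fixes f :: "int poly" and S S' :: "nat set" and n s' :: nat and \<epsilon> :: real
  assumes "n = Polynomial.degree f" and "n \<ge> 1"
    and "finite S" and "\<forall>p\<in>S. Factorial_Ring.prime p"
    and "S' = {p \<in> S. has_padic_int_root f p}"
    and "s' = card S'" and "s' \<ge> 1"
    and "\<forall>p\<in>S'. splits_completely p (splitting_field f)"
    and "\<forall>p\<in>S'. \<not> int p dvd Polynomial.lead_coeff f"
    and "0 < \<epsilon>" and "\<epsilon> < real (max_root_multiplicity f) / real n"
  shows "\<exists>c1>0. \<exists>c2>0. \<forall>\<^sub>F B in at_top.
           c1 * (B powr (1 - real n * \<epsilon> / real (max_root_multiplicity f)) * ln B ^ (s' - 1))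
             \<le> real (count_large_S_part f S \<epsilon> B) \<and>
           real (count_large_S_part f S \<epsilon> B)
             \<le> c2 * (B powr (1 - real n * \<epsilon> / real (max_root_multiplicity f)) * ln B ^ (s' - 1))"
proof -
  define R where "R = max_root_multiplicity f"
  define \<theta> where "\<theta> = real n * \<epsilon> / real R"
  define good where "good x \<longleftrightarrow> 0 < \<bar>real_of_int (poly f x)\<bar> powr \<epsilon> \<and>
      \<bar>real_of_int (poly f x)\<bar> powr \<epsilon> \<le> real (S_part S (poly f x))" for x
  have f0: "f \<noteq> 0" using assms(1,2) by auto
  have R: "0 < R"
    using assms(10,11) by (cases "R = 0") (auto simp: R_def)
  have \<theta>: "0 < \<theta>" "\<theta> < 1"
    using R assms(2,10,11) by (auto simp: \<theta>_def R_def field_simps)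
  have \<theta>R: "x powr (\<theta> * real R) = (x powr real n) powr \<epsilon>" for x
    using R by (simp add: \<theta>_def powr_powr)
  have S'S: "S' \<subseteq> S" using assms(5) by auto
  have fin': "finite S'" using S'S assms(3) by (rule finite_subset)
  interpret prime_set S' "Max S'"
  proof
    show "S' \<noteq> {}" using assms(6,7) by auto
  qed (use fin' S'S assms(4) in auto)
  have "\<forall>p\<in>S'. \<exists>as C. finite as \<and> (\<forall>a\<in>as. \<forall>k. [a (Suc k) = a k] (mod int p ^ k)) \<and>
    (\<forall>x e. int p ^ e dvd poly f x \<longrightarrow> (\<exists>a\<in>as. \<exists>k. e \<le> R * k + C \<and> [x = a k] (mod int p ^ k))) \<and>
    (\<exists>a\<in>as. \<forall>k x. [x = a k] (mod int p ^ k) \<longrightarrow> int p ^ (R * k) dvd poly f x)"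
    using splits_completely_approximations prime_Q assms(1,2,8,9) unfolding R_def by simp
  then obtain A C1 where A: "\<And>p. p \<in> S' \<Longrightarrow> finite (A p)"
      "\<And>p a k. p \<in> S' \<Longrightarrow> a \<in> A p \<Longrightarrow> [a (Suc k) = a k] (mod int p ^ k)"
      "\<And>p x e. p \<in> S' \<Longrightarrow> int p ^ e dvd poly f x \<Longrightarrow> \<exists>a\<in>A p. \<exists>k. e \<le> R * k + C1 p \<and> [x = a k] (mod int p ^ k)"
    and A': "\<forall>p\<in>S'. \<exists>a\<in>A p. \<forall>k x. [x = a k] (mod int p ^ k) \<longrightarrow> int p ^ (R * k) dvd poly f x"
    by metis
  obtain a where a: "\<And>p. p \<in> S' \<Longrightarrow> a p \<in> A p"
      "\<And>p k x. p \<in> S' \<Longrightarrow> [x = a p k] (mod int p ^ k) \<Longrightarrow> int p ^ (R * k) dvd poly f x"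
    using A' by metis
  have "\<forall>p\<in>S - S'. \<exists>C. \<forall>x e. int p ^ e dvd poly f x \<longrightarrow> e \<le> C"
    using multiplicity_bounded_if_no_padic_root assms(4,5) by (auto simp: prime_gt_0_nat)
  then obtain C2 where C2: "\<And>p x e. p \<in> S - S' \<Longrightarrow> int p ^ e dvd poly f x \<Longrightarrow> e \<le> C2 p"
    by metis
  \<comment> \<open>Bounds the part of \<open>[f(x)]_S\<close> not explained by closeness: the
    excess \<open>C1\<close> over \<open>R * k\<close> at primes of \<open>S'\<close>, and
    everything at the other primes.\<close>
  define C where "C = (\<Prod>p\<in>S'. real p ^ C1 p) * (\<Prod>p\<in>S - S'. real p ^ C2 p)"
  have S_pos: "1 \<le> p" if "p \<in> S" for p
    using assms(4) that by (metis One_nat_def Suc_leI prime_gt_0_nat)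
  have C: "0 < C"
    unfolding C_def using S_pos S'S by (intro mult_pos_pos prod_pos) force+
  have S_part_split: "real (S_part S y) = (\<Prod>p\<in>S'. real p ^ multiplicity (int p) y) *
      (\<Prod>p\<in>S - S'. real p ^ multiplicity (int p) y)" for y
    unfolding S_part_def using S'S assms(3) by (simp add: prod.subset_diff[of S' S] mult.commute)
  have H_R: "real (H k) ^ R = (\<Prod>p\<in>S'. real p ^ (R * k p))" for k
    by (simp add: H_def prod_power_distrib mult.commute flip: power_mult)
  define x0 where "x0 = max 1 (2 * (\<Sum>i<n. \<bar>Polynomial.coeff f i\<bar>))"
  \<comment> \<open>For large \<open>x\<close>,
    \<open>(\<bar>x\<bar> ^ n / 2) powr \<epsilon> \<le> H ^ R * C\<close>; the R-th root of this
    inequality yields \<open>t1\<close> and the exponent \<open>\<theta>\<close>.\<close>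
  define t1 where "t1 = ((1 / 2) powr \<epsilon> / C) powr (1 / real R)"
  have upper: "\<exists>\<alpha>\<in>Pi\<^sub>E S' A. \<exists>k\<in>S' \<rightarrow>\<^sub>E UNIV. t1 * \<bar>real_of_int x\<bar> powr \<theta> \<le> real (H k) \<and> near \<alpha> k x"
    if good: "good x" and x: "real_of_int x0 \<le> \<bar>real_of_int x\<bar>" for x
  proof -
    have "\<forall>p\<in>S'. \<exists>a\<in>A p. \<exists>k. multiplicity (int p) (poly f x) \<le> R * k + C1 p \<and> [x = a k] (mod int p ^ k)"
      using A(3) multiplicity_dvd by blast
    then obtain \<alpha> k where ak: "\<And>p. p \<in> S' \<Longrightarrow> \<alpha> p \<in> A p"
        "\<And>p. p \<in> S' \<Longrightarrow> multiplicity (int p) (poly f x) \<le> R * k p + C1 p"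
        "\<And>p. p \<in> S' \<Longrightarrow> [x = \<alpha> p (k p)] (mod int p ^ k p)"
      by metis
    define \<alpha>' where "\<alpha>' = restrict \<alpha> S'"
    define k' where "k' = restrict k S'"
    have "real (S_part S (poly f x)) \<le> (\<Prod>p\<in>S'. real p ^ (R * k p + C1 p)) * (\<Prod>p\<in>S - S'. real p ^ C2 p)"
      unfolding S_part_split
    proof (intro mult_mono prod_mono conjI power_increasing prod_nonneg)
      fix p assume "p \<in> S - S'"
      then show "multiplicity (int p) (poly f x) \<le> C2 p"
        using C2 multiplicity_dvd by blast
    qed (use ak(2) S_pos S'S in auto)
    also have "\<dots> = real (H k') ^ R * C"
      by (simp add: H_R C_def k'_def power_add prod.distrib)
    finally have S_part_le: "real (S_part S (poly f x)) \<le> real (H k') ^ R * C" .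
    have x1: "x \<noteq> 0" "2 * (\<Sum>i<n. \<bar>Polynomial.coeff f i\<bar>) \<le> \<bar>x\<bar>"
      using x by (auto simp: x0_def simp flip: of_int_abs)
    have "\<bar>x\<bar> ^ n \<le> 2 * \<bar>poly f x\<bar>"
      using abs_poly_ge[OF f0] x1 unfolding assms(1) by blast
    then have "real_of_int (\<bar>x\<bar> ^ n) \<le> real_of_int (2 * \<bar>poly f x\<bar>)"
      by (simp only: of_int_le_iff)
    then have "1 / 2 * \<bar>real_of_int x\<bar> powr real n \<le> \<bar>real_of_int (poly f x)\<bar>"
      using x1(1) by (simp add: powr_realpow)
    then have "(1 / 2 * \<bar>real_of_int x\<bar> powr real n) powr \<epsilon> \<le> \<bar>real_of_int (poly f x)\<bar> powr \<epsilon>"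
      using assms(10) by (intro powr_mono2) auto
    also have "\<dots> \<le> real (H k') ^ R * C"
      using good S_part_le unfolding good_def by linarith
    finally have "(1 / 2) powr \<epsilon> * \<bar>real_of_int x\<bar> powr (\<theta> * real R) \<le> real (H k') ^ R * C"
      unfolding \<theta>R by (subst (asm) powr_mult) auto
    then have "(1 / 2) powr \<epsilon> / C * \<bar>real_of_int x\<bar> powr (\<theta> * real R) \<le> real (H k') powr real R"
      using C H_pos[of k'] by (simp add: pos_divide_le_eq powr_realpow)
    then have "((1 / 2) powr \<epsilon> / C * \<bar>real_of_int x\<bar> powr (\<theta> * real R)) powr (1 / real R)
        \<le> (real (H k') powr real R) powr (1 / real R)"
      using C by (intro powr_mono2) auto
    also have "\<dots> = real (H k')"
      using R H_pos[of k'] by (simp add: powr_powr)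
    also have "((1 / 2) powr \<epsilon> / C * \<bar>real_of_int x\<bar> powr (\<theta> * real R)) powr (1 / real R)
        = t1 * \<bar>real_of_int x\<bar> powr \<theta>"
      using R C by (subst powr_mult) (auto simp: t1_def powr_powr)
    finally have "t1 * \<bar>real_of_int x\<bar> powr \<theta> \<le> real (H k')" .
    moreover have "\<alpha>' \<in> Pi\<^sub>E S' A" "k' \<in> S' \<rightarrow>\<^sub>E UNIV" "near \<alpha>' k' x"
      using ak by (auto simp: \<alpha>'_def k'_def near_def)
    ultimately show ?thesis by blast
  qed
  define D where "D = 1 + real_of_int (\<Sum>i\<le>n. \<bar>Polynomial.coeff f i\<bar>)"
  have D: "0 < D" unfolding D_def by (intro add_pos_nonneg) (auto intro: sum_nonneg)
  \<comment> \<open>Makes \<open>(t2 * B powr \<theta>) powr R\<close> equal to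
    \<open>(D * B powr n) powr \<epsilon>\<close>, a bound for
    \<open>\<bar>f(x)\<bar> powr \<epsilon>\<close>.\<close>
  define t2 where "t2 = D powr (\<epsilon> / real R)"
  \<comment> \<open>Zeros of \<open>f\<close> may be close to the chosen limits to any order, but
    they violate \<open>0 < \<bar>f(x)\<bar> powr \<epsilon>\<close>; they form the exceptional
    set.\<close>
  have lower: "good x \<or> x \<in> {x. poly f x = 0}"
    if B: "(1::real) \<le> B" "0 < x" "real_of_int x \<le> B" and k: "t2 * B powr \<theta> \<le> real (H k)" and near: "near a k x" for B x k
  proof (cases "poly f x = 0")
    case False
    have "\<bar>poly f x\<bar> \<le> (\<Sum>i\<le>n. \<bar>Polynomial.coeff f i\<bar>) * \<bar>x\<bar> ^ n"
      using abs_poly_le[of x f] B(2) unfolding assms(1) by simp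
    then have "real_of_int \<bar>poly f x\<bar> \<le> real_of_int ((\<Sum>i\<le>n. \<bar>Polynomial.coeff f i\<bar>) * \<bar>x\<bar> ^ n)"
      by (simp only: of_int_le_iff)
    also have "\<dots> = (D - 1) * real_of_int x ^ n"
      using B(2) by (simp add: D_def)
    also have "\<dots> \<le> D * B ^ n"
      using B D by (intro mult_mono power_mono) (auto simp: D_def sum_nonneg)
    finally have "\<bar>real_of_int (poly f x)\<bar> \<le> D * B powr real n"
      using B(1) by (simp add: powr_realpow)
    then have "\<bar>real_of_int (poly f x)\<bar> powr \<epsilon> \<le> (D * B powr real n) powr \<epsilon>"
      using assms(10) by (intro powr_mono2) auto
    also have "\<dots> = (t2 * B powr \<theta>) powr real R"
      using R D B(1) \<theta>R[of B] by (simp add: t2_def powr_mult powr_powr)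
    also have "\<dots> \<le> real (H k) powr real R"
      using k by (intro powr_mono2) (auto simp: t2_def)
    also have "\<dots> = (\<Prod>p\<in>S'. real p ^ (R * k p)) * 1"
      using H_pos[of k] by (simp add: powr_realpow H_R)
    \<comment> \<open>The trailing 1 is a lower bound for the contribution of the primes outside
      \<open>S'\<close>.\<close>
    also have "\<dots> \<le> real (S_part S (poly f x))"
      unfolding S_part_split
    proof (intro mult_mono prod_mono conjI power_increasing prod_nonneg prod_ge_1 one_le_power)
      fix p assume p: "p \<in> S'"
      then have "int p ^ (R * k p) dvd poly f x"
        using a(2) near by (auto simp: near_def)
      then show "R * k p \<le> multiplicity (int p) (poly f x)"
        using False Q_ge_2[OF p] by (intro multiplicity_geI) auto
    qed (use S_pos S'S in auto)
    finally show ?thesis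
      using False by (simp add: good_def)
  qed simp
  have count: "count_large_S_part f S \<epsilon> B = card {x. \<bar>real_of_int x\<bar> \<le> B \<and> good x}" for B
    by (simp add: count_large_S_part_def good_def)
  have "\<exists>D>0. \<forall>\<^sub>F B in at_top. real (card {x. \<bar>real_of_int x\<bar> \<le> B \<and> good x})
      \<le> D * (B powr (1 - \<theta>) * ln B ^ (card S' - 1))"
  proof (rule count_upper[OF A(1) A(2) \<theta>])
    show "0 < t1" using C by (simp add: t1_def)
  qed (use upper in auto)
  then obtain c2 where c2: "c2 > 0" "\<forall>\<^sub>F B in at_top. real (count_large_S_part f S \<epsilon> B) \<le> c2 * (B powr (1 - \<theta>) * ln B ^ (s' - 1))"
    unfolding count assms(6) by blast
  have "\<exists>c>0. \<forall>\<^sub>F B in at_top. c * (B powr (1 - \<theta>) * ln B ^ (card S' - 1))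
      \<le> real (card {x. \<bar>real_of_int x\<bar> \<le> B \<and> good x})"
  proof (rule count_lower)
    show "[a p (Suc k) = a p k] (mod int p ^ k)" if "p \<in> S'" for p k
      using A(2) a(1) that by blast
    show "finite {x. poly f x = 0}" using f0 by (rule poly_roots_finite)
    show "0 < t2" using D by (simp add: t2_def)
  qed (use \<theta> lower in auto)
  then obtain c1 where c1: "c1 > 0" "\<forall>\<^sub>F B in at_top. c1 * (B powr (1 - \<theta>) * ln B ^ (s' - 1)) \<le> real (count_large_S_part f S \<epsilon> B)"
    unfolding count assms(6) by blast
  have "\<forall>\<^sub>F B in at_top. c1 * (B powr (1 - \<theta>) * ln B ^ (s' - 1)) \<le> real (count_large_S_part f S \<epsilon> B) \<and>
      real (count_large_S_part f S \<epsilon> B) \<le> c2 * (B powr (1 - \<theta>) * ln B ^ (s' - 1))"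
    using c1(2) c2(2) by eventually_elim simp
  then show ?thesis
    using c1(1) c2(1) unfolding \<theta>_def R_def by blast
qed


end
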